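(* Let $\Sigma$ be a compact surface and let $\pi$ be the Poisson structure on $\Sigma$ constructed in the context. Then the Poisson diffeomorphism group $\mathrm{Poiss}(\Sigma,\pi)$, endowed with the $C^\infty$-topology, is not locally path-connected.
   Context: For a Poisson manifold $(M,\pi)$, $\mathrm{Poiss}(M,\pi)=\{\phi\in \mathrm{Diff}(M) : \phi_*(\pi)=\pi\}$, with the $C^\infty$-topology inherited from $\mathrm{Diff}(M)$. In dimension two any smooth bivector field is a Poisson structure. Construction of $\pi$. Let $\Sigma$ be a compact surface. Fix a closed disk $B\subset\Sigma$ contained in a coordinate chart $x=(x_1,x_2)$ which identifies $B$ with the closed disk of radius $1$ around $0$ in $\mathbb{R}^2=\mathbb{C}$. Fix a smooth function $\chi:\mathbb{R}\to[0,1]$ with $\chi(t)=0$ for $|t|\ge 1$, $\chi(t)>0$ for $1/2<|t|<1$, and $\chi(t)=1$ for $|t|\le 1/2$. For $p\in\mathbb{R}^2$ and $\delta>0$ let $$\pi_{p,\delta}(x):=\chi\left(\frac{|x-p|}{\delta}\right)\partial_{x_1}\wedge\partial_{x_2}.$$ For integers $n\ge 4$ and $1\le s\le 2^n$ let $$p(n,s):=\frac1n\exp\left(\frac{2\pi s}{2^n}i\right),\qquad \delta_n:=\frac{1}{n2^n},\qquad \pi_n:=\frac{1}{n!}\sum_{s=1}^{2^n}\pi_{p(n,s),\delta_n}$$ (in the formula for $p(n,s)$, $\pi$ is the number and $i$ the imaginary unit). The series $\sum_n\pi_n$ converges uniformly on $B$ together with all derivatives, and $\pi$ is the smooth bivector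 field on $\Sigma$ given by $$\pi|_B=\sum_{n=4}^\infty\pi_n,\qquad \pi|_{\Sigma\setminus B}=0.$$ *)

theory Defs
  imports "HOL-Analysis.Analysis"
begin

section \<open>Smooth maps between Euclidean spaces\<close>

text \<open>
  \<open>iter_deriv [v1, \<dots>, vk] f\<close> is the iterated directional derivative
  \<open>D_v1 (\<dots> (D_vk f))\<close>. A map is $C^\infty$ on an open set iff all of these exist there and are
  differentiable. Derivatives are real ones throughout, also when the space
  is \<^typ>\<open>complex\<close>, which only serves as $\mathbb{R}^2$ (basis \<open>1, \<i>\<close>).
\<close>

fun iter_deriv :: "'e list \<Rightarrow> ('e::real_normed_vector \<Rightarrow> 'f::real_normed_vector) \<Rightarrow> 'e \<Rightarrow> 'f" where
  "iter_deriv [] f = f"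
| "iter_deriv (v # vs) f = (\<lambda>x. frechet_derivative (iter_deriv vs f) (at x) v)"

definition smooth_on :: "'e::real_normed_vector set \<Rightarrow> ('e \<Rightarrow> 'f::real_normed_vector) \<Rightarrow> bool" where
  "smooth_on U f \<longleftrightarrow> open U \<and> (\<forall>vs. \<forall>x\<in>U. iter_deriv vs f differentiable (at x))"


section \<open>Smooth manifolds without boundary\<close>

text \<open>
  A chart is a pair of its domain and its coordinate map; the values of the coordinate map outside
  the domain are irrelevant. The underlying space of a manifold is a whole type.
\<close>

type_synonym ('a, 'e) chart = "'a set \<times> ('a \<Rightarrow> 'e)"

abbreviation cdom :: "('a, 'e) chart \<Rightarrow> 'a set" where "cdom c \<equiv> fst c"
abbreviation coord :: "('a, 'e) chart \<Rightarrow> 'a \<Rightarrow> 'e" where "coord c \<equiv> snd c"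

definition is_chart :: "('a::topological_space, 'e::euclidean_space) chart \<Rightarrow> bool" where
  "is_chart c \<longleftrightarrow> open (cdom c) \<and> open (coord c ` cdom c) \<and>
     homeomorphism (cdom c) (coord c ` cdom c) (coord c) (inv_into (cdom c) (coord c))"

text \<open>The local representative \<open>d \<circ> f \<circ> c\<inverse>\<close> of a map, meaningful on \<open>c(dom c \<inter> f\<inverse>(dom d))\<close>.\<close>

definition chart_rep :: "('a, 'e) chart \<Rightarrow> ('b, 'f) chart \<Rightarrow> ('a \<Rightarrow> 'b) \<Rightarrow> 'e \<Rightarrow> 'f" where
  "chart_rep c d f = coord d \<circ> f \<circ> inv_into (cdom c) (coord c)"

definition compatible ::
    "('a, 'e::real_normed_vector) chart \<Rightarrow> ('a, 'e) chart \<Rightarrow> bool" where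
  "compatible c d \<longleftrightarrow>
     smooth_on (coord c ` (cdom c \<inter> cdom d)) (chart_rep c d id) \<and>
     smooth_on (coord d ` (cdom d \<inter> cdom c)) (chart_rep d c id)"

definition smooth_structure ::
    "('a::{t2_space,second_countable_topology}, 'e::euclidean_space) chart set \<Rightarrow> bool" where
  "smooth_structure A \<longleftrightarrow>
     (\<forall>c\<in>A. is_chart c) \<and> (\<Union>c\<in>A. cdom c) = UNIV \<and> (\<forall>c\<in>A. \<forall>d\<in>A. compatible c d) \<and>
     (\<forall>c. is_chart c \<and> (\<forall>d\<in>A. compatible c d) \<longrightarrow> c \<in> A)"

definition smooth_map ::
    "('a::topological_space, 'e::real_normed_vector) chart set \<Rightarrow>
     ('b::topological_space, 'f::real_normed_vector) chart set \<Rightarrow> ('a \<Rightarrow> 'b) \<Rightarrow> bool" where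
  "smooth_map A B f \<longleftrightarrow> continuous_on UNIV f \<and>
     (\<forall>c\<in>A. \<forall>d\<in>B. smooth_on (coord c ` (cdom c \<inter> f -` cdom d)) (chart_rep c d f))"

definition Diff :: "('a::topological_space, 'e::real_normed_vector) chart set \<Rightarrow> ('a \<Rightarrow> 'a) set" where
  "Diff A = {f. bij f \<and> smooth_map A A f \<and> smooth_map A A (inv f)}"


section \<open>The $C^\infty$-topology\<close>

text \<open>
  Hirsch's subbasic neighbourhoods of \<open>f\<close>: uniform closeness on a compact \<open>K\<close>, in charts, of all
  partial derivatives up to order \<open>r\<close>. On a compact source the weak and the strong (Whitney)
  $C^\infty$-topologies coincide.
\<close>

definition Cinf_nbhd ::
    "('a::topological_space, 'e::euclidean_space) chart set \<Rightarrow>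
     ('b::topological_space, 'f::real_normed_vector) chart set \<Rightarrow> ('a \<Rightarrow> 'b) \<Rightarrow>
     ('a, 'e) chart \<Rightarrow> ('b, 'f) chart \<Rightarrow> 'a set \<Rightarrow> nat \<Rightarrow> real \<Rightarrow> ('a \<Rightarrow> 'b) set" where
  "Cinf_nbhd A B f c d K r \<epsilon> = {g. smooth_map A B g \<and> g ` K \<subseteq> cdom d \<and>
     (\<forall>vs. set vs \<subseteq> Basis \<and> length vs \<le> r \<longrightarrow>
        (\<forall>z\<in>coord c ` K.
           norm (iter_deriv vs (chart_rep c d f) z - iter_deriv vs (chart_rep c d g) z) < \<epsilon>))}"

definition Cinf_topology ::
    "('a::topological_space, 'e::euclidean_space) chart set \<Rightarrow>
     ('b::topological_space, 'f::real_normed_vector) chart set \<Rightarrow> ('a \<Rightarrow> 'b) topology" where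
  "Cinf_topology A B = topology_generated_by
     {Cinf_nbhd A B f c d K r \<epsilon> | f c d K r \<epsilon>.
        smooth_map A B f \<and> c \<in> A \<and> d \<in> B \<and> compact K \<and> K \<subseteq> cdom c \<and> f ` K \<subseteq> cdom d \<and> \<epsilon> > 0}"

definition Diff_topology ::
    "('a::topological_space, 'e::euclidean_space) chart set \<Rightarrow> ('a \<Rightarrow> 'a) topology" where
  "Diff_topology A = subtopology (Cinf_topology A A) (Diff A)"


section \<open>Bivectors and bivector fields\<close>

text \<open>
  A bivector on \<open>E\<close> is an element of \<open>\<Lambda>\<^sup>2E\<close>, i.e. an alternating bilinear form on the dual of the
  (finite-dimensional) space \<open>E\<close>. The type below consists of all bilinear forms on the dual.
\<close>

type_synonym 'e bivector = "('e \<Rightarrow>\<^sub>L real) \<Rightarrow>\<^sub>L ('e \<Rightarrow>\<^sub>L real) \<Rightarrow>\<^sub>L real"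

definition wedge :: "'e::real_normed_vector \<Rightarrow> 'e \<Rightarrow> 'e bivector" where
  "wedge u v = Blinfun (\<lambda>\<alpha> :: 'e \<Rightarrow>\<^sub>L real. Blinfun (\<lambda>\<beta> :: 'e \<Rightarrow>\<^sub>L real. \<alpha> u * \<beta> v - \<alpha> v * \<beta> u))"

text \<open>The map \<open>\<Lambda>\<^sup>2L\<close> induced by a linear map \<open>L\<close>.\<close>

definition bivector_push ::
    "('e::real_normed_vector \<Rightarrow>\<^sub>L 'f::real_normed_vector) \<Rightarrow> 'e bivector \<Rightarrow> 'f bivector" where
  "bivector_push L P = Blinfun (\<lambda>\<alpha> :: 'f \<Rightarrow>\<^sub>L real. Blinfun (\<lambda>\<beta> :: 'f \<Rightarrow>\<^sub>L real. P (\<alpha> o\<^sub>L L) (\<beta> o\<^sub>L L)))"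

text \<open>The differential at \<open>q\<close> of a map, written in charts \<open>c\<close> around \<open>q\<close> and \<open>d\<close> around \<open>f q\<close>.\<close>

definition chart_deriv ::
    "('a, 'e::real_normed_vector) chart \<Rightarrow> ('b, 'f::real_normed_vector) chart \<Rightarrow>
     ('a \<Rightarrow> 'b) \<Rightarrow> 'a \<Rightarrow> ('e \<Rightarrow>\<^sub>L 'f)" where
  "chart_deriv c d f q = Blinfun (frechet_derivative (chart_rep c d f) (at (coord c q)))"

text \<open>
  A bivector field is given by its values in charts: \<open>P q c\<close> is the value at \<open>q\<close> written in the
  chart \<open>c\<close> around \<open>q\<close>. The values in different charts correspond under \<open>\<Lambda>\<^sup>2\<close> of the differential
  of the coordinate change. Smoothness is not part of the predicate below.
\<close>

type_synonym ('a, 'e) bivector_field = "'a \<Rightarrow> ('a, 'e) chart \<Rightarrow> 'e bivector"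

definition is_bivector_field ::
    "('a, 'e::real_normed_vector) chart set \<Rightarrow> ('a, 'e) bivector_field \<Rightarrow> bool" where
  "is_bivector_field A P \<longleftrightarrow>
     (\<forall>c\<in>A. \<forall>q\<in>cdom c. \<forall>\<alpha>. P q c \<alpha> \<alpha> = 0) \<and>
     (\<forall>c\<in>A. \<forall>d\<in>A. \<forall>q\<in>cdom c \<inter> cdom d. P q d = bivector_push (chart_deriv c d id q) (P q c))"

text \<open>\<open>f\<^sub>* P = Q\<close> for a diffeomorphism \<open>f\<close>, i.e. \<open>Q (f q) = \<Lambda>\<^sup>2(T\<^sub>q f) (P q)\<close> for all \<open>q\<close>.\<close>

definition pushes_to ::
    "('a, 'e::real_normed_vector) chart set \<Rightarrow> ('a \<Rightarrow> 'a) \<Rightarrow>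
     ('a, 'e) bivector_field \<Rightarrow> ('a, 'e) bivector_field \<Rightarrow> bool" where
  "pushes_to A f P Q \<longleftrightarrow>
     (\<forall>c\<in>A. \<forall>d\<in>A. \<forall>q\<in>cdom c \<inter> f -` cdom d.
        Q (f q) d = bivector_push (chart_deriv c d f q) (P q c))"

definition Poiss ::
    "('a::topological_space, 'e::real_normed_vector) chart set \<Rightarrow> ('a, 'e) bivector_field \<Rightarrow>
     ('a \<Rightarrow> 'a) set" where
  "Poiss A P = {f \<in> Diff A. pushes_to A f P P}"

definition Poiss_topology ::
    "('a::topological_space, 'e::euclidean_space) chart set \<Rightarrow> ('a, 'e) bivector_field \<Rightarrow>
     ('a \<Rightarrow> 'a) topology" where
  "Poiss_topology A P = subtopology (Diff_topology A) (Poiss A P)"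


section \<open>The Poisson structure\<close>

definition cutoff :: "(real \<Rightarrow> real) \<Rightarrow> bool" where
  "cutoff \<kappa> \<longleftrightarrow> smooth_on UNIV \<kappa> \<and> (\<forall>t. 0 \<le> \<kappa> t \<and> \<kappa> t \<le> 1) \<and>
     (\<forall>t. \<bar>t\<bar> \<ge> 1 \<longrightarrow> \<kappa> t = 0) \<and> (\<forall>t. 1/2 < \<bar>t\<bar> \<and> \<bar>t\<bar> < 1 \<longrightarrow> \<kappa> t > 0) \<and>
     (\<forall>t. \<bar>t\<bar> \<le> 1/2 \<longrightarrow> \<kappa> t = 1)"

definition pi_disk :: "(real \<Rightarrow> real) \<Rightarrow> complex \<Rightarrow> real \<Rightarrow> complex \<Rightarrow> complex bivector" where
  "pi_disk \<kappa> p \<delta> x = \<kappa> (norm (x - p) / \<delta>) *\<^sub>R wedge 1 \<i>"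

definition centre :: "nat \<Rightarrow> nat \<Rightarrow> complex" where
  "centre n s = of_real (1 / real n) * exp (of_real (2 * pi * real s / 2 ^ n) * \<i>)"

definition disk_radius :: "nat \<Rightarrow> real" where
  "disk_radius n = 1 / (real n * 2 ^ n)"

definition pi_ring :: "(real \<Rightarrow> real) \<Rightarrow> nat \<Rightarrow> complex \<Rightarrow> complex bivector" where
  "pi_ring \<kappa> n x = (1 / fact n) *\<^sub>R (\<Sum>s=1..2^n. pi_disk \<kappa> (centre n s) (disk_radius n) x)"

definition pi_series :: "(real \<Rightarrow> real) \<Rightarrow> complex \<Rightarrow> complex bivector" where
  "pi_series \<kappa> x = (\<Sum>n. pi_ring \<kappa> (n + 4) x)"

text \<open>
  The bivector field that in the chart \<open>x\<close> is \<open>pi_series \<kappa>\<close> on the disk \<open>B\<close>, and that vanishes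
  outside \<open>B\<close>; in a further chart \<open>c\<close> it is obtained by the coordinate change from \<open>x\<close> to \<open>c\<close>.
\<close>

definition poisson_structure ::
    "(real \<Rightarrow> real) \<Rightarrow> ('a, complex) chart \<Rightarrow> 'a set \<Rightarrow> ('a, complex) bivector_field" where
  "poisson_structure \<kappa> x B q c =
     (if q \<in> B then bivector_push (chart_deriv x c id q) (pi_series \<kappa> (coord x q)) else 0)"


section \<open>Well-definedness\<close>

lemma wedge_apply: "wedge u v \<alpha> \<beta> = \<alpha> u * \<beta> v - \<alpha> v * \<beta> u"
proof -
  have 1: "bounded_linear (\<lambda>\<beta> :: 'a \<Rightarrow>\<^sub>L real. \<alpha> u * \<beta> v - \<alpha> v * \<beta> u)" for \<alpha> :: "'a \<Rightarrow>\<^sub>L real"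
    by (intro bounded_linear_intros)
  have "bounded_linear (\<lambda>\<alpha> :: 'a \<Rightarrow>\<^sub>L real. Blinfun (\<lambda>\<beta> :: 'a \<Rightarrow>\<^sub>L real. \<alpha> u * \<beta> v - \<alpha> v * \<beta> u))"
  proof (rule bounded_linear_intro[where K = "2 * norm u * norm v"])
    fix \<alpha> :: "'a \<Rightarrow>\<^sub>L real"
    have "\<bar>\<alpha> u * \<beta> v - \<alpha> v * \<beta> u\<bar> \<le> norm \<alpha> * (2 * norm u * norm v) * norm \<beta>" for \<beta> :: "'a \<Rightarrow>\<^sub>L real"
    proof -
      have "\<bar>\<alpha> u * \<beta> v\<bar> \<le> (norm \<alpha> * norm u) * (norm \<beta> * norm v)"
        "\<bar>\<alpha> v * \<beta> u\<bar> \<le> (norm \<alpha> * norm v) * (norm \<beta> * norm u)"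
        using norm_blinfun[of \<alpha> u] norm_blinfun[of \<beta> v] norm_blinfun[of \<alpha> v] norm_blinfun[of \<beta> u]
        unfolding abs_mult by (auto intro!: mult_mono)
      then show ?thesis by (simp add: algebra_simps)
    qed
    then show "norm (Blinfun (\<lambda>\<beta> :: 'a \<Rightarrow>\<^sub>L real. \<alpha> u * \<beta> v - \<alpha> v * \<beta> u)) \<le> norm \<alpha> * (2 * norm u * norm v)"
      by (intro norm_blinfun_bound) (auto simp: bounded_linear_Blinfun_apply[OF 1])
  qed (rule blinfun_eqI, simp only: bounded_linear_Blinfun_apply[OF 1],
       simp add: bounded_linear_Blinfun_apply[OF 1] blinfun.bilinear_simps, simp add: algebra_simps)+
  from bounded_linear_Blinfun_apply[OF this] show ?thesis
    by (simp add: wedge_def bounded_linear_Blinfun_apply[OF 1])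
qed

lemma bivector_push_apply:
  fixes L :: "'e::real_normed_vector \<Rightarrow>\<^sub>L 'f::real_normed_vector"
  shows "bivector_push L P \<alpha> \<beta> = P (\<alpha> o\<^sub>L L) (\<beta> o\<^sub>L L)"
proof -
  have lin: "bounded_linear (\<lambda>\<beta> :: 'f \<Rightarrow>\<^sub>L real. \<beta> o\<^sub>L L)"
    by (rule bounded_bilinear.bounded_linear_left[OF bounded_bilinear_blinfun_compose])
  have 1: "bounded_linear (\<lambda>\<beta> :: 'f \<Rightarrow>\<^sub>L real. Q (\<beta> o\<^sub>L L))" for Q :: "('e \<Rightarrow>\<^sub>L real) \<Rightarrow>\<^sub>L real"
    by (rule bounded_linear_compose[OF blinfun.bounded_linear_right lin])
  have "bounded_linear (\<lambda>\<alpha> :: 'f \<Rightarrow>\<^sub>L real. Blinfun (\<lambda>\<beta> :: 'f \<Rightarrow>\<^sub>L real. P (\<alpha> o\<^sub>L L) (\<beta> o\<^sub>L L)))"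
  proof (rule bounded_linear_intro[where K = "norm P * norm L * norm L"])
    fix \<alpha> :: "'f \<Rightarrow>\<^sub>L real"
    have "\<bar>P (\<alpha> o\<^sub>L L) (\<beta> o\<^sub>L L)\<bar> \<le> norm \<alpha> * (norm P * norm L * norm L) * norm \<beta>" for \<beta> :: "'f \<Rightarrow>\<^sub>L real"
    proof -
      have "\<bar>P (\<alpha> o\<^sub>L L) (\<beta> o\<^sub>L L)\<bar> \<le> norm (P (\<alpha> o\<^sub>L L)) * norm (\<beta> o\<^sub>L L)"
        using norm_blinfun[of "P (\<alpha> o\<^sub>L L)" "\<beta> o\<^sub>L L"] by simp
      also have "\<dots> \<le> (norm P * (norm \<alpha> * norm L)) * (norm \<beta> * norm L)"
        by (intro mult_mono norm_blinfun_compose order_trans[OF norm_blinfun] mult_left_mono) auto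
      finally show ?thesis by (simp add: algebra_simps)
    qed
    then show "norm (Blinfun (\<lambda>\<beta> :: 'f \<Rightarrow>\<^sub>L real. P (\<alpha> o\<^sub>L L) (\<beta> o\<^sub>L L))) \<le> norm \<alpha> * (norm P * norm L * norm L)"
      by (intro norm_blinfun_bound) (auto simp: bounded_linear_Blinfun_apply[OF 1])
  qed (rule blinfun_eqI, simp only: bounded_linear_Blinfun_apply[OF 1],
       simp add: bounded_linear_Blinfun_apply[OF 1] blinfun.bilinear_simps
         bounded_bilinear.add_left[OF bounded_bilinear_blinfun_compose]
         bounded_bilinear.scaleR_left[OF bounded_bilinear_blinfun_compose])+
  from bounded_linear_Blinfun_apply[OF this] show ?thesis
    by (simp add: bivector_push_def bounded_linear_Blinfun_apply[OF 1])
qed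

lemma blinfun_compose_assoc: "(a o\<^sub>L b) o\<^sub>L c = a o\<^sub>L (b o\<^sub>L c)"
  by (rule blinfun_eqI) simp

lemma blinfun_compose_id: "a o\<^sub>L id_blinfun = a"
  by (rule blinfun_eqI) simp

lemma bivector_push_push: "bivector_push M (bivector_push L P) = bivector_push (M o\<^sub>L L) P"
  by (intro blinfun_eqI) (simp add: bivector_push_apply blinfun_compose_assoc)

lemma bivector_push_zero: "bivector_push L 0 = 0"
  by (intro blinfun_eqI) (simp add: bivector_push_apply)

lemma inv_coord:
  assumes "is_chart c" "q \<in> cdom c"
  shows "inv_into (cdom c) (coord c) (coord c q) = q"
  using assms by (auto simp: is_chart_def homeomorphism_def)

lemma transition_differentiable:
  assumes "smooth_structure A" "c \<in> A" "d \<in> A" "q \<in> cdom c" "q \<in> cdom d"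
  shows "chart_rep c d id differentiable (at (coord c q))"
proof -
  have "compatible c d" using assms by (auto simp: smooth_structure_def)
  then have "\<forall>x\<in>coord c ` (cdom c \<inter> cdom d). iter_deriv [] (chart_rep c d id) differentiable (at x)"
    unfolding compatible_def smooth_on_def by blast
  then show ?thesis using assms by auto
qed

lemma chart_deriv_transition:
  assumes "smooth_structure A" "x \<in> A" "c \<in> A" "d \<in> A" "q \<in> cdom x" "q \<in> cdom c" "q \<in> cdom d"
  shows "chart_deriv c d id q o\<^sub>L chart_deriv x c id q = chart_deriv x d id q"
proof -
  let ?S = "coord x ` (cdom x \<inter> cdom c)"
  have ch: "is_chart x" "is_chart c" and "compatible x c"
    using assms by (auto simp: smooth_structure_def)
  then have op: "open ?S" by (simp add: compatible_def smooth_on_def)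
  have pt: "chart_rep x c id (coord x q) = coord c q"
    using inv_coord[OF ch(1)] assms by (simp add: chart_rep_def)
  have dx: "chart_rep x c id differentiable (at (coord x q))"
    and dd: "chart_rep x d id differentiable (at (coord x q))"
    and dc: "chart_rep c d id differentiable (at (chart_rep x c id (coord x q)))"
    by (auto simp: pt intro!: transition_differentiable[OF assms(1)] assms)
  have "frechet_derivative (chart_rep x d id) (at (coord x q)) =
        frechet_derivative (chart_rep c d id \<circ> chart_rep x c id) (at (coord x q))"
    by (rule frechet_derivative_transform_within_open[OF dd op])
       (use assms ch in \<open>auto simp: chart_rep_def inv_coord\<close>)
  also have "\<dots> = frechet_derivative (chart_rep c d id) (at (coord c q)) \<circ>
      frechet_derivative (chart_rep x c id) (at (coord x q))"
    using frechet_derivative_compose[OF dx dc] unfolding pt .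
  finally have eq: "frechet_derivative (chart_rep x d id) (at (coord x q)) = \<dots>" .
  have bl: "bounded_linear (frechet_derivative f (at z))" if "f differentiable (at z)"
    for f :: "'b \<Rightarrow> 'b" and z
    using that frechet_derivative_works has_derivative_bounded_linear by blast
  show ?thesis
    using bl[OF dx] bl[OF dd] bl[OF dc]
    by (intro blinfun_eqI) (simp add: chart_deriv_def bounded_linear_Blinfun_apply pt fun_cong[OF eq])
qed

lemma chart_deriv_id:
  assumes "smooth_structure A" "x \<in> A" "q \<in> cdom x"
  shows "chart_deriv x x id q = id_blinfun"
proof -
  have ch: "is_chart x" using assms by (auto simp: smooth_structure_def)
  then have op: "open (coord x ` cdom x)" by (simp add: is_chart_def)
  have "frechet_derivative (chart_rep x x id) (at (coord x q)) =
        frechet_derivative (\<lambda>z. z) (at (coord x q))"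
    by (rule frechet_derivative_transform_within_open[OF _ op])
       (use assms ch transition_differentiable[OF assms(1,2,2,3,3)] in
         \<open>auto simp: chart_rep_def inv_coord\<close>)
  then show ?thesis
    by (intro blinfun_eqI) (simp add: chart_deriv_def bounded_linear_Blinfun_apply)
qed

lemma pi_ring_wedge:
  "pi_ring \<kappa> n x =
     ((\<Sum>s=1..2^n. \<kappa> (norm (x - centre n s) / disk_radius n)) / fact n) *\<^sub>R wedge 1 \<i>"
  by (simp add: pi_ring_def pi_disk_def scaleR_left.sum [symmetric])

lemma summable_pi_ring:
  assumes "cutoff \<kappa>"
  shows "summable (\<lambda>n. pi_ring \<kappa> n x)"
proof -
  have "norm (pi_ring \<kappa> n x) \<le> (inverse (fact n) * 2 ^ n) * norm (wedge 1 \<i>)" for n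
  proof -
    let ?S = "\<Sum>s=1..2^n. \<kappa> (norm (x - centre n s) / disk_radius n)"
    have "?S \<le> real (card {1..(2::nat)^n}) * 1" "0 \<le> ?S"
      using assms by (intro sum_bounded_above sum_nonneg; auto simp: cutoff_def)+
    then show ?thesis
      unfolding pi_ring_wedge norm_scaleR
      by (intro mult_right_mono) (auto simp: divide_simps)
  qed
  then show ?thesis
    by (intro summable_comparison_test'[OF summable_mult2[OF summable_exp[of 2]]]) auto
qed

lemma pi_series_alternating:
  assumes "cutoff \<kappa>"
  shows "pi_series \<kappa> x \<alpha> \<alpha> = 0"
proof -
  have "(\<lambda>n. pi_ring \<kappa> (n + 4) x \<alpha> \<alpha>) sums (pi_series \<kappa> x \<alpha> \<alpha>)"
    unfolding pi_series_def
    using summable_ignore_initial_segment[OF summable_pi_ring[OF assms], of 4]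
    by (intro bounded_linear.sums[OF blinfun.bounded_linear_left] summable_sums) auto
  then show ?thesis
    by (simp add: pi_ring_wedge blinfun.bilinear_simps wedge_apply sums_iff)
qed

theorem is_bivector_field_poisson_structure:
  assumes "smooth_structure A" "cutoff \<kappa>" "x \<in> A" "B \<subseteq> cdom x"
  shows "is_bivector_field A (poisson_structure \<kappa> x B)"
  using assms
  by (auto simp: is_bivector_field_def poisson_structure_def bivector_push_push bivector_push_zero
      bivector_push_apply pi_series_alternating chart_deriv_transition subset_iff)

lemma poisson_structure_in_disk:
  assumes "smooth_structure A" "x \<in> A" "B \<subseteq> cdom x" "q \<in> B"
  shows "poisson_structure \<kappa> x B q x = pi_series \<kappa> (coord x q)"
  using assms
  by (intro blinfun_eqI) (auto simp: poisson_structure_def chart_deriv_id subset_iff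
      bivector_push_apply blinfun_compose_id)

end

theory Submission
  imports Defs
begin

text \<open>
  The rotation by \<open>2\<pi> / 2\<^sup>n\<close> maps each disk of the \<open>n\<close>-th ring to the next one. Cutting its
  angle off outside a thin annulus that contains this ring and no other one gives a Poisson
  diffeomorphism: where the angle varies, the bivector field vanishes. The derivatives of order \<open>r\<close>
  of the angle are \<open>O(n\<^sup>4\<^sup>r / 2\<^sup>n)\<close> near the origin, so these diffeomorphisms converge to the identity.
  In a locally path-connected group, almost all of them could therefore be joined to the identity.
  A Poisson diffeomorphism preserves the set where the bivector field is nonzero, a disjoint union
  of open disks, so along a path starting at the identity the image of the centre of a disk cannot
  leave that disk.
\<close>

text \<open>In units of 1/n, the disks of ring n lie within 1/2^n of radius 1, while the
  neighbouring rings are about 1/n away. The function \<open>annulus n\<close> magnifies this gap: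
  its modulus is below 1/2 on ring n and above 1 on every other ring. These are the thresholds built
  into \<open>cutoff\<close>, so \<kappa> itself can cut off the angle. The bound on ring n rests on
  6 n^2 \<le> 2^n, which holds from n = 9 on; hence all twists have index \<open>n + 9\<close>. The
  factor n^4 per derivative is the leading coefficient of \<open>annulus n\<close>. The main
  obstacle is the topology. Its subbasic sets use arbitrary pairs of charts and are centred at
  arbitrary maps, so convergence must survive composition with coordinate changes that are defined
  only locally, and must become uniform on compact sets. Joint limits in the index and the point do
  both. At a point where the field vanishes both there and at its image, the Poisson condition is
  trivial whatever the derivative; at all other points the twist is locally a rigid rotation, of
  determinant 1. The contradiction evaluates a path of maps at one single centre.\<close>

section \<open>Convergence of sequences of maps with all derivatives\<close>

text \<open>
  Joint convergence as \<open>(n, y) \<rightarrow> (\<infinity>, z)\<close> amounts to locally uniform convergence to a continuous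
  limit. For a constant sequence the predicate expresses \<open>C\<^sup>k\<close>-smoothness, so that each closure
  property below covers smoothness and convergence at once.
\<close>

fun Ck_lim :: "nat \<Rightarrow> 'e set \<Rightarrow> (nat \<Rightarrow> 'e::euclidean_space \<Rightarrow> 'f::real_normed_vector) \<Rightarrow>
    ('e \<Rightarrow> 'f) \<Rightarrow> bool" where
  "Ck_lim 0 U F f \<longleftrightarrow> (\<forall>z\<in>U. ((\<lambda>p. F (fst p) (snd p)) \<longlongrightarrow> f z) (sequentially \<times>\<^sub>F nhds z))"
| "Ck_lim (Suc k) U F f \<longleftrightarrow>
     (\<forall>z\<in>U. ((\<lambda>p. F (fst p) (snd p)) \<longlongrightarrow> f z) (sequentially \<times>\<^sub>F nhds z)) \<and>
     (\<forall>n. \<forall>z\<in>U. F n differentiable (at z)) \<and> (\<forall>z\<in>U. f differentiable (at z)) \<and>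
     (\<forall>v. Ck_lim k U (\<lambda>n z. frechet_derivative (F n) (at z) v)
        (\<lambda>z. frechet_derivative f (at z) v))"

lemma Ck_lim_tendsto:
  assumes "Ck_lim k U F f" "z \<in> U"
  shows "((\<lambda>p. F (fst p) (snd p)) \<longlongrightarrow> f z) (sequentially \<times>\<^sub>F nhds z)"
  using assms by (cases k) auto

lemma eventually_sequentially_prod_nhds:
  assumes "open U" "z \<in> U"
  shows "eventually (\<lambda>p. snd p \<in> U) (sequentially \<times>\<^sub>F nhds z)"
  using assms by (auto simp: eventually_prod_filter case_prod_beta
      intro!: exI[of _ "\<lambda>_. True"] exI[of _ "\<lambda>y. y \<in> U"] eventually_nhds_in_open)

text \<open>Openness of \<open>U\<close> makes the Frechet derivatives agree on \<open>U\<close> as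
  well, which feeds the induction. This is how a convergence proved for an explicit formula is
  transferred to a chart representative.\<close>

lemma Ck_lim_cong:
  fixes F G :: "nat \<Rightarrow> 'e::euclidean_space \<Rightarrow> 'f::real_normed_vector"
  assumes "open U" "Ck_lim k U F f"
    "\<And>n z. z \<in> U \<Longrightarrow> F n z = G n z" "\<And>z. z \<in> U \<Longrightarrow> f z = g z"
  shows "Ck_lim k U G g"
  using assms(2-)
proof (induction k arbitrary: F f G g)
  case 0
  have "((\<lambda>p. G (fst p) (snd p)) \<longlongrightarrow> g z) (sequentially \<times>\<^sub>F nhds z)" if "z \<in> U" for z
    using Lim_transform_eventually[OF Ck_lim_tendsto[OF 0(1) that]
        eventually_mono[OF eventually_sequentially_prod_nhds[OF assms(1) that]]] 0(2,3) that
    by auto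
  then show ?case by simp
next
  case (Suc k)
  have 1: "((\<lambda>p. G (fst p) (snd p)) \<longlongrightarrow> g z) (sequentially \<times>\<^sub>F nhds z)" if "z \<in> U" for z
    using Lim_transform_eventually[OF Ck_lim_tendsto[OF Suc.prems(1) that]
        eventually_mono[OF eventually_sequentially_prod_nhds[OF assms(1) that]]] Suc.prems(2,3) that
    by auto
  have dF: "F n differentiable (at z)" "f differentiable (at z)" if "z \<in> U" for n z
    using Suc.prems that by auto
  have dG: "G n differentiable (at z)" "g differentiable (at z)" if "z \<in> U" for n z
  proof -
    show "G n differentiable (at z)"
      using dF(1)[OF that, of n]
        has_derivative_transform_within_open[where f = "F n" and g = "G n", OF _ assms(1) that Suc.prems(2)]
      unfolding differentiable_def by blast
    show "g differentiable (at z)"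
      using dF(2)[OF that]
        has_derivative_transform_within_open[where f = f and g = g, OF _ assms(1) that Suc.prems(3)]
      unfolding differentiable_def by blast
  qed
  have eq: "frechet_derivative (F n) (at z) = frechet_derivative (G n) (at z)"
      "frechet_derivative f (at z) = frechet_derivative g (at z)" if "z \<in> U" for n z
    using that dF[OF that] assms(1) Suc.prems(2,3)
    by (auto intro!: frechet_derivative_transform_within_open)
  have "Ck_lim k U (\<lambda>n z. frechet_derivative (G n) (at z) v) (\<lambda>z. frechet_derivative g (at z) v)" for v
  proof (rule Suc.IH)
    show "Ck_lim k U (\<lambda>n z. frechet_derivative (F n) (at z) v) (\<lambda>z. frechet_derivative f (at z) v)"
      using Suc.prems(1) by simp
  qed (simp_all only: eq)
  then show ?case using 1 dG by simp
qed

text \<open>Working form of the second clause of \<open>Ck_lim\<close>: the derivatives may be any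
  explicit formulas. Uniqueness of the derivative identifies them with
  \<open>frechet_derivative\<close>, a choice operator, on \<open>U\<close>.\<close>

lemma Ck_lim_SucI:
  assumes "open U" "Ck_lim 0 U F f"
    and "\<And>n z. z \<in> U \<Longrightarrow> (F n has_derivative F' n z) (at z)"
    and "\<And>z. z \<in> U \<Longrightarrow> (f has_derivative f' z) (at z)"
    and "\<And>v. Ck_lim k U (\<lambda>n z. F' n z v) (\<lambda>z. f' z v)"
  shows "Ck_lim (Suc k) U F f"
proof -
  have "Ck_lim k U (\<lambda>n z. frechet_derivative (F n) (at z) v) (\<lambda>z. frechet_derivative f (at z) v)" for v
    by (rule Ck_lim_cong[OF assms(1) assms(5)[of v]])
       (auto simp: frechet_derivative_at[OF assms(3), symmetric]
          frechet_derivative_at[OF assms(4), symmetric])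
  moreover have "F n differentiable (at z)" "f differentiable (at z)" if "z \<in> U" for n z
    using assms(3)[OF that] assms(4)[OF that] by (auto simp: differentiable_def)
  ultimately show ?thesis using assms(2) by simp
qed

lemma Ck_lim_Suc_derivative:
  assumes "Ck_lim (Suc k) U F f" "z \<in> U"
  shows "(F n has_derivative frechet_derivative (F n) (at z)) (at z)"
    "(f has_derivative frechet_derivative f (at z)) (at z)"
  using assms by (auto simp: frechet_derivative_works[symmetric])

lemma Ck_lim_mono:
  assumes "Ck_lim k U F f" "j \<le> k" "V \<subseteq> U"
  shows "Ck_lim j V F f"
  using assms(1,2)
proof (induction j arbitrary: k F f)
  case 0
  then show ?case using assms(3) Ck_lim_tendsto by fastforce
next
  case (Suc j)
  then obtain l where "k = Suc l" "j \<le> l" by (cases k) auto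
  then show ?case using Suc.prems assms(3) by (auto intro!: Suc.IH[of l])
qed

lemma Ck_lim_const: "Ck_lim k U (\<lambda>n z. a) (\<lambda>z. a)"
proof (induction k arbitrary: a)
  case (Suc k)
  then show ?case by auto
qed simp

lemma Ck_lim_add:
  assumes "open U" "Ck_lim k U F f" "Ck_lim k U G g"
  shows "Ck_lim k U (\<lambda>n z. F n z + G n z) (\<lambda>z. f z + g z)"
  using assms(2-)
proof (induction k arbitrary: F f G g)
  case 0
  then show ?case by (auto intro!: tendsto_add)
next
  case (Suc k)
  note d = Ck_lim_Suc_derivative[OF Suc.prems(1)] Ck_lim_Suc_derivative[OF Suc.prems(2)]
  show ?case
  proof (rule Ck_lim_SucI[OF assms(1)])
    show "Ck_lim 0 U (\<lambda>n z. F n z + G n z) (\<lambda>z. f z + g z)"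
      using Suc.prems by (auto intro!: tendsto_add)
  next
    fix n z assume "z \<in> U"
    then show "((\<lambda>z. F n z + G n z) has_derivative
        (\<lambda>v. frechet_derivative (F n) (at z) v + frechet_derivative (G n) (at z) v)) (at z)"
      and "((\<lambda>z. f z + g z) has_derivative
        (\<lambda>v. frechet_derivative f (at z) v + frechet_derivative g (at z) v)) (at z)"
      by (auto intro!: has_derivative_add d)
  next
    fix v
    show "Ck_lim k U (\<lambda>n z. frechet_derivative (F n) (at z) v + frechet_derivative (G n) (at z) v)
        (\<lambda>z. frechet_derivative f (at z) v + frechet_derivative g (at z) v)"
      using Suc.prems by (intro Suc.IH) auto
  qed
qed

lemma Ck_lim_sum:
  assumes "open U" "\<And>b. b \<in> I \<Longrightarrow> Ck_lim k U (F b) (f b)"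
  shows "Ck_lim k U (\<lambda>n z. \<Sum>b\<in>I. F b n z) (\<lambda>z. \<Sum>b\<in>I. f b z)"
  using assms(2)
  by (induction I rule: infinite_finite_induct) (auto intro!: Ck_lim_const Ck_lim_add[OF assms(1)])

text \<open>The product rule gives two summands, each with one factor differentiated and the other
  not. The induction hypothesis therefore also needs the undifferentiated factors at the lower
  order.\<close>

lemma (in bounded_bilinear) Ck_lim:
  assumes "open U" "Ck_lim k U F f" "Ck_lim k U G g"
  shows "Ck_lim k U (\<lambda>n z. prod (F n z) (G n z)) (\<lambda>z. prod (f z) (g z))"
  using assms(2-)
proof (induction k arbitrary: F f G g)
  case 0
  then show ?case by (auto intro!: tendsto)
next
  case (Suc k)
  have le: "Ck_lim k U F f" "Ck_lim k U G g"
    using Ck_lim_mono[OF Suc.prems(1)] Ck_lim_mono[OF Suc.prems(2)] by auto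
  show ?case
  proof (rule Ck_lim_SucI[OF assms(1)])
    show "Ck_lim 0 U (\<lambda>n z. prod (F n z) (G n z)) (\<lambda>z. prod (f z) (g z))"
      using Suc.prems by (auto intro!: tendsto)
  next
    fix n z assume "z \<in> U"
    then show "((\<lambda>z. prod (F n z) (G n z)) has_derivative
        (\<lambda>v. prod (F n z) (frechet_derivative (G n) (at z) v) +
              prod (frechet_derivative (F n) (at z) v) (G n z))) (at z)"
      by (intro FDERIV Ck_lim_Suc_derivative(1)[OF Suc.prems(1)] Ck_lim_Suc_derivative(1)[OF Suc.prems(2)])
  next
    fix z assume "z \<in> U"
    then show "((\<lambda>z. prod (f z) (g z)) has_derivative
        (\<lambda>v. prod (f z) (frechet_derivative g (at z) v) +
              prod (frechet_derivative f (at z) v) (g z))) (at z)"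
      by (intro FDERIV Ck_lim_Suc_derivative(2)[OF Suc.prems(1)] Ck_lim_Suc_derivative(2)[OF Suc.prems(2)])
  next
    fix v
    show "Ck_lim k U (\<lambda>n z. prod (F n z) (frechet_derivative (G n) (at z) v) +
              prod (frechet_derivative (F n) (at z) v) (G n z))
        (\<lambda>z. prod (f z) (frechet_derivative g (at z) v) + prod (frechet_derivative f (at z) v) (g z))"
      using Suc.prems le by (intro Ck_lim_add assms(1) Suc.IH) auto
  qed
qed

lemma (in bounded_linear) Ck_lim:
  assumes "open U" "Ck_lim k U F g"
  shows "Ck_lim k U (\<lambda>n z. f (F n z)) (\<lambda>z. f (g z))"
  using assms(2)
proof (induction k arbitrary: F g)
  case 0
  then show ?case by (auto intro!: tendsto)
next
  case (Suc k)
  show ?case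
  proof (rule Ck_lim_SucI[OF assms(1)])
    show "Ck_lim 0 U (\<lambda>n z. f (F n z)) (\<lambda>z. f (g z))"
      using Suc.prems by (auto intro!: tendsto)
  next
    fix n z assume "z \<in> U"
    then show "((\<lambda>z. f (F n z)) has_derivative (\<lambda>v. f (frechet_derivative (F n) (at z) v))) (at z)"
      and "((\<lambda>z. f (g z)) has_derivative (\<lambda>v. f (frechet_derivative g (at z) v))) (at z)"
      by (intro has_derivative Ck_lim_Suc_derivative[OF Suc.prems]; assumption)+
  next
    fix v
    show "Ck_lim k U (\<lambda>n z. f (frechet_derivative (F n) (at z) v))
        (\<lambda>z. f (frechet_derivative g (at z) v))"
      using Suc.prems by (intro Suc.IH) auto
  qed
qed

lemma Ck_lim_id:
  assumes "open U"
  shows "Ck_lim k U (\<lambda>n z. z) (\<lambda>z. z)"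
proof -
  have 0: "Ck_lim 0 U (\<lambda>n z. z) (\<lambda>z. z)"
    using filterlim_snd by auto
  show ?thesis
  proof (cases k)
    case 0
    with \<open>Ck_lim 0 U (\<lambda>n z. z) (\<lambda>z. z)\<close> show ?thesis by simp
  next
    case (Suc k)
    then show ?thesis using Ck_lim_SucI[OF assms 0, of "\<lambda>n z v. v" "\<lambda>z v. v"]
      by (auto intro!: derivative_eq_intros Ck_lim_const)
  qed
qed

section \<open>Iterated derivatives and smoothness\<close>

lemma iter_deriv_append: "iter_deriv (us @ vs) f = iter_deriv us (iter_deriv vs f)"
  by (induction us) auto

text \<open>The last direction of the list is applied to the function first, and
  \<open>Ck_lim\<close> unfolds from the innermost derivative; hence the induction from the end of
  the list.\<close>

lemma Ck_lim_iter_deriv: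
  assumes "Ck_lim (length vs + k) U F f"
  shows "Ck_lim k U (\<lambda>n. iter_deriv vs (F n)) (iter_deriv vs f)"
  using assms
proof (induction vs arbitrary: F f rule: rev_induct)
  case (snoc v vs)
  then have "Ck_lim (length vs + k) U (\<lambda>n. iter_deriv [v] (F n)) (iter_deriv [v] f)" by simp
  from snoc.IH[OF this] show ?case by (simp add: iter_deriv_append)
qed simp

text \<open>For a constant sequence joint convergence is continuity of the function, which
  differentiability provides. The forward induction is on the order with the list of directions kept
  general, because differentiating \<open>iter_deriv vs f\<close> lengthens that list.\<close>

lemma smooth_on_iff_Ck_lim:
  fixes f :: "'e::euclidean_space \<Rightarrow> 'f::real_normed_vector"
  shows "smooth_on U f \<longleftrightarrow> open U \<and> (\<forall>k. Ck_lim k U (\<lambda>n. f) f)"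
proof (intro iffI conjI allI)
  fix k
  assume *: "smooth_on U f"
  have "Ck_lim k U (\<lambda>n. iter_deriv vs f) (iter_deriv vs f)" for vs
  proof (induction k arbitrary: vs)
    case (0 vs)
    have "((\<lambda>p::nat \<times> 'e. iter_deriv vs f (snd p)) \<longlongrightarrow> iter_deriv vs f z) (sequentially \<times>\<^sub>F nhds z)"
      if "z \<in> U" for z
    proof -
      have "isCont (iter_deriv vs f) z"
        using * that unfolding smooth_on_def by (blast intro: differentiable_imp_continuous_within)
      then have "((\<lambda>p::nat \<times> 'e. iter_deriv vs f (snd p)) \<longlongrightarrow> iter_deriv vs f z) (sequentially \<times>\<^sub>F nhds z)"
        by (intro filterlim_compose[OF _ filterlim_snd])
           (simp add: continuous_at tendsto_at_iff_tendsto_nhds)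
      then show ?thesis .
    qed
    then show ?case by simp
  next
    case (Suc k vs)
    have "Ck_lim k U (\<lambda>n. iter_deriv (v # vs) f) (iter_deriv (v # vs) f)" for v
      by (rule Suc)
    moreover have "iter_deriv vs f differentiable (at z)" if "z \<in> U" for z
      using * that unfolding smooth_on_def by blast
    ultimately show ?case using Ck_lim_mono[OF Suc[of vs], of 0 U] by simp
  qed
  from this[of "[]"] show "Ck_lim k U (\<lambda>n. f) f" by simp
next
  assume *: "open U \<and> (\<forall>k. Ck_lim k U (\<lambda>n. f) f)"
  have "iter_deriv vs f differentiable (at z)" if "z \<in> U" for vs z
  proof -
    have "Ck_lim (Suc 0) U (\<lambda>n. iter_deriv vs f) (iter_deriv vs f)"
      using * by (intro Ck_lim_iter_deriv) blast
    with that show ?thesis by simp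
  qed
  with * show "smooth_on U f" by (simp add: smooth_on_def)
qed (simp add: smooth_on_def)

text \<open>\<open>Ck_lim\<close> demands differentiability of every term, not only of late ones.
  Smoothness of each single twist thus comes for free from the convergence of the twists.\<close>

lemma smooth_on_Ck_lim_nth:
  assumes "open U" "\<And>k. Ck_lim k U F f"
  shows "smooth_on U (F n)"
proof -
  have "iter_deriv vs (F n) differentiable (at z)" if "z \<in> U" for vs z
  proof -
    have "Ck_lim (Suc 0) U (\<lambda>n. iter_deriv vs (F n)) (iter_deriv vs f)"
      using assms by (intro Ck_lim_iter_deriv)
    with that show ?thesis by simp
  qed
  with assms show ?thesis by (simp add: smooth_on_def)
qed

lemma smooth_on_frechet_derivative:
  assumes "smooth_on U f"
  shows "smooth_on U (\<lambda>x. frechet_derivative f (at x) v)"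
proof -
  have "iter_deriv vs (\<lambda>x. frechet_derivative f (at x) v) = iter_deriv (vs @ [v]) f" for vs
    by (simp add: iter_deriv_append)
  with assms show ?thesis by (simp add: smooth_on_def)
qed

lemma smooth_on_derivative:
  assumes "smooth_on U f" "z \<in> U"
  shows "(f has_derivative frechet_derivative f (at z)) (at z)"
proof -
  have "iter_deriv [] f differentiable (at z)" using assms unfolding smooth_on_def by blast
  then show ?thesis by (simp add: frechet_derivative_works)
qed

lemma smooth_on_cong:
  fixes f :: "'e::euclidean_space \<Rightarrow> 'f::real_normed_vector"
  assumes "smooth_on U f" "\<And>z. z \<in> U \<Longrightarrow> f z = g z"
  shows "smooth_on U g"
  using assms unfolding smooth_on_iff_Ck_lim by (meson Ck_lim_cong)

lemma smooth_on_subset: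
  assumes "smooth_on U f" "V \<subseteq> U" "open V"
  shows "smooth_on V f"
  using assms unfolding smooth_on_def by blast

lemma smooth_on_locally:
  assumes "\<And>z. z \<in> U \<Longrightarrow> \<exists>V. z \<in> V \<and> V \<subseteq> U \<and> smooth_on V f"
  shows "smooth_on U f"
proof -
  have "open U" using assms open_subopen unfolding smooth_on_def by meson
  with assms show ?thesis unfolding smooth_on_def by blast
qed

lemma smooth_on_imp_Ck_lim:
  fixes f :: "'e::euclidean_space \<Rightarrow> 'f::real_normed_vector"
  assumes "smooth_on U f"
  shows "Ck_lim k U (\<lambda>n. f) f"
  using assms by (simp add: smooth_on_iff_Ck_lim)

text \<open>The gain of joint limits: (n, F n y) tends to (\<infinity>, f z), so the limit of
  \<open>H\<close> at f z can be composed with it directly, without separate equicontinuity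
  estimates.\<close>

lemma Ck_lim_0_compose:
  assumes "Ck_lim 0 V H h" "Ck_lim 0 U F f" "\<And>z. z \<in> U \<Longrightarrow> f z \<in> V"
  shows "Ck_lim 0 U (\<lambda>n z. H n (F n z)) (\<lambda>z. h (f z))"
proof -
  have "((\<lambda>p. H (fst p) (F (fst p) (snd p))) \<longlongrightarrow> h (f z)) (sequentially \<times>\<^sub>F nhds z)" if "z \<in> U" for z
  proof -
    have "filterlim (\<lambda>p. (fst p, F (fst p) (snd p))) (sequentially \<times>\<^sub>F nhds (f z)) (sequentially \<times>\<^sub>F nhds z)"
      by (intro filterlim_Pair filterlim_fst Ck_lim_tendsto[OF assms(2) that])
    from filterlim_compose[OF Ck_lim_tendsto[OF assms(1,3)] this] that show ?thesis by simp
  qed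
  then show ?thesis by simp
qed

text \<open>In the chain rule the outer derivative is taken in a direction that varies with the
  point, whereas \<open>Ck_lim\<close> controls fixed directions only. Expanding the direction in
  the standard basis leaves sums of products to which the closure rules and the induction hypothesis
  apply.\<close>

lemma Ck_lim_compose:
  fixes H :: "nat \<Rightarrow> 'f::euclidean_space \<Rightarrow> 'g::real_normed_vector"
    and F :: "nat \<Rightarrow> 'e::euclidean_space \<Rightarrow> 'f"
  assumes "open U" "Ck_lim k V H h" "Ck_lim k U F f"
    "\<And>n z. z \<in> U \<Longrightarrow> F n z \<in> V" "\<And>z. z \<in> U \<Longrightarrow> f z \<in> V"
  shows "Ck_lim k U (\<lambda>n z. H n (F n z)) (\<lambda>z. h (f z))"
  using assms(2-)
proof (induction k arbitrary: F f H h)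
  case (0 F f H h)
  show ?case by (rule Ck_lim_0_compose[OF 0(1,2,4)])
next
  case (Suc k F f H h)
  have expand: "D w = (\<Sum>b\<in>Basis. (w \<bullet> b) *\<^sub>R D b)"
    if "(g has_derivative D) (at y)" for g and D :: "'f \<Rightarrow> 'g" and w y
  proof -
    have lin: "linear D" using that by (rule has_derivative_linear)
    show ?thesis
      by (subst euclidean_representation[of w, symmetric])
         (simp only: linear_sum[OF lin] linear_scale[OF lin])
  qed
  note dH = Ck_lim_Suc_derivative[OF Suc.prems(1)] and dF = Ck_lim_Suc_derivative[OF Suc.prems(2)]
  have le: "Ck_lim k U F f" using Ck_lim_mono[OF Suc.prems(2)] by simp
  show ?case
  proof (rule Ck_lim_SucI[OF assms(1)])
    show "Ck_lim 0 U (\<lambda>n z. H n (F n z)) (\<lambda>z. h (f z))"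
      by (rule Ck_lim_0_compose[OF Ck_lim_mono[OF Suc.prems(1)] Ck_lim_mono[OF Suc.prems(2)] Suc.prems(4)]) auto
  next
    fix n z assume z: "z \<in> U"
    have D: "(H n has_derivative frechet_derivative (H n) (at (F n z))) (at (F n z))"
      by (rule dH(1)[OF Suc.prems(3)[OF z]])
    have "((\<lambda>z. H n (F n z)) has_derivative
        (\<lambda>v. frechet_derivative (H n) (at (F n z)) (frechet_derivative (F n) (at z) v))) (at z)"
      by (rule has_derivative_compose[OF dF(1)[OF z] D])
    then show "((\<lambda>z. H n (F n z)) has_derivative
        (\<lambda>v. \<Sum>b\<in>Basis. (frechet_derivative (F n) (at z) v \<bullet> b) *\<^sub>R frechet_derivative (H n) (at (F n z)) b)) (at z)"
      by (rule has_derivative_eq_rhs) (rule ext, rule expand[OF D])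
  next
    fix z assume z: "z \<in> U"
    have D: "(h has_derivative frechet_derivative h (at (f z))) (at (f z))"
      by (rule dH(2)[OF Suc.prems(4)[OF z]])
    have "((\<lambda>z. h (f z)) has_derivative
        (\<lambda>v. frechet_derivative h (at (f z)) (frechet_derivative f (at z) v))) (at z)"
      by (rule has_derivative_compose[OF dF(2)[OF z] D])
    then show "((\<lambda>z. h (f z)) has_derivative
        (\<lambda>v. \<Sum>b\<in>Basis. (frechet_derivative f (at z) v \<bullet> b) *\<^sub>R frechet_derivative h (at (f z)) b)) (at z)"
      by (rule has_derivative_eq_rhs) (rule ext, rule expand[OF D])
  next
    fix v
    show "Ck_lim k U (\<lambda>n z. \<Sum>b\<in>Basis. (frechet_derivative (F n) (at z) v \<bullet> b) *\<^sub>R frechet_derivative (H n) (at (F n z)) b)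
        (\<lambda>z. \<Sum>b\<in>Basis. (frechet_derivative f (at z) v \<bullet> b) *\<^sub>R frechet_derivative h (at (f z)) b)"
    proof (intro Ck_lim_sum bounded_bilinear.Ck_lim[OF bounded_bilinear_scaleR] assms(1))
      fix b :: 'f
      show "Ck_lim k U (\<lambda>n z. frechet_derivative (F n) (at z) v \<bullet> b) (\<lambda>z. frechet_derivative f (at z) v \<bullet> b)"
        using Suc.prems(2) by (intro bounded_linear.Ck_lim[OF bounded_linear_inner_left] assms(1)) simp
      have "Ck_lim k V (\<lambda>n y. frechet_derivative (H n) (at y) b) (\<lambda>y. frechet_derivative h (at y) b)"
        using Suc.prems(1) by simp
      then show "Ck_lim k U (\<lambda>n z. frechet_derivative (H n) (at (F n z)) b) (\<lambda>z. frechet_derivative h (at (f z)) b)"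
        by (rule Suc.IH[OF _ le Suc.prems(3,4)])
    qed
  qed
qed

lemma smooth_on_compose:
  fixes f :: "'e::euclidean_space \<Rightarrow> 'f::euclidean_space"
  assumes "smooth_on U f" "smooth_on V h" "f ` U \<subseteq> V"
  shows "smooth_on U (\<lambda>z. h (f z))"
proof -
  have "open U" "Ck_lim k U (\<lambda>n. f) f" for k
    using assms(1) unfolding smooth_on_iff_Ck_lim by auto
  then have "Ck_lim k U (\<lambda>n z. h (f z)) (\<lambda>z. h (f z))" for k
    by (rule Ck_lim_compose[where V = V and F = "\<lambda>n. f", OF _ smooth_on_imp_Ck_lim[OF assms(2)]]) (use assms(3) in auto)
  with \<open>open U\<close> show ?thesis unfolding smooth_on_iff_Ck_lim by simp
qed

section \<open>Decay of an angle cut off on thin annuli\<close>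

lemma iter_deriv_cong:
  fixes f g :: "'e::euclidean_space \<Rightarrow> 'f::real_normed_vector"
  assumes "open U" "\<And>z. z \<in> U \<Longrightarrow> f z = g z" "z \<in> U"
  shows "iter_deriv vs f z = iter_deriv vs g z"
  using assms(3)
proof (induction vs arbitrary: z)
  case (Cons v vs)
  have "(iter_deriv vs f has_derivative D) (at z) \<longleftrightarrow> (iter_deriv vs g has_derivative D) (at z)" for D
    using has_derivative_transform_within_open[OF _ assms(1) Cons.prems] Cons.IH by metis
  then show ?case by (simp add: frechet_derivative_def)
qed (use assms(2) in simp)

lemma iter_deriv_zero: "iter_deriv vs (\<lambda>_. 0) = (\<lambda>_. 0)"
  by (induction vs) auto

text \<open>Every derivative is continuous on [-1, 1] and vanishes outside, where \<kappa> coincides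
  with the zero function on an open set.\<close>

lemma cutoff_iter_deriv_bounded:
  assumes "cutoff \<kappa>"
  shows "\<exists>M. \<forall>t. \<bar>iter_deriv vs \<kappa> t\<bar> \<le> M"
proof -
  have "continuous_on {-1..1} (iter_deriv vs \<kappa>)"
    using assms unfolding cutoff_def smooth_on_def
    by (auto intro!: continuous_at_imp_continuous_on differentiable_imp_continuous_within)
  then have "bounded (iter_deriv vs \<kappa> ` {-1..1})"
    by (intro compact_imp_bounded compact_continuous_image) auto
  then obtain M where M: "\<And>t. t \<in> {-1..1} \<Longrightarrow> \<bar>iter_deriv vs \<kappa> t\<bar> \<le> M"
    unfolding bounded_real by (metis image_eqI)
  have "iter_deriv vs \<kappa> t = 0" if "t \<notin> {-1..1}" for t
  proof -
    have "iter_deriv vs \<kappa> t = iter_deriv vs (\<lambda>_. 0) t"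
      using that assms by (intro iter_deriv_cong[of "- {-1..1}"]) (auto simp: cutoff_def)
    then show ?thesis by (simp add: iter_deriv_zero)
  qed
  moreover have "0 \<le> M" using M[of 0] by auto
  ultimately show ?thesis using M by (metis abs_zero)
qed

lemma smooth_on_real_mult:
  fixes f g :: "'e::euclidean_space \<Rightarrow> real"
  assumes "smooth_on U f" "smooth_on U g"
  shows "smooth_on U (\<lambda>z. f z * g z)"
  using assms unfolding smooth_on_iff_Ck_lim
  by (auto intro!: bounded_bilinear.Ck_lim[OF bounded_bilinear_mult, where F = "\<lambda>n. f" and G = "\<lambda>n. g"])

lemma smooth_on_bounded_linear:
  fixes f :: "'e::euclidean_space \<Rightarrow> 'f::real_normed_vector"
  assumes "bounded_linear f"
  shows "smooth_on UNIV f"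
  unfolding smooth_on_iff_Ck_lim
  using bounded_linear.Ck_lim[OF assms open_UNIV Ck_lim_id] by auto

text \<open>No convergence of \<open>g\<close> is available, since its argument is stretched ever
  more; a uniform bound on \<open>g\<close>, local boundedness of \<open>p\<close> and the factor
  \<open>s n\<close> suffice.\<close>

lemma Ck_lim_0_null:
  fixes p :: "'e::euclidean_space \<Rightarrow> real"
  assumes "smooth_on UNIV p" "\<And>n z. \<bar>g n z\<bar> \<le> M" "s \<longlonglongrightarrow> 0"
  shows "Ck_lim 0 UNIV (\<lambda>n z. s n * (p z * g n z)) (\<lambda>z. 0)"
proof -
  have "((\<lambda>q. s (fst q) * (p (snd q) * g (fst q) (snd q))) \<longlongrightarrow> 0) (sequentially \<times>\<^sub>F nhds z)" for z
  proof (rule tendsto_0_le)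
    have "((\<lambda>q::nat \<times> 'e. s (fst q)) \<longlongrightarrow> 0) (sequentially \<times>\<^sub>F nhds z)"
      by (rule filterlim_compose[OF assms(3) filterlim_fst])
    moreover have "((\<lambda>q::nat \<times> 'e. p (snd q)) \<longlongrightarrow> p z) (sequentially \<times>\<^sub>F nhds z)"
      using Ck_lim_tendsto[of 0 UNIV "\<lambda>n. p" p z] assms(1) unfolding smooth_on_iff_Ck_lim by blast
    ultimately have "((\<lambda>q. s (fst q) * p (snd q)) \<longlongrightarrow> 0 * p z) (sequentially \<times>\<^sub>F nhds z)"
      by (rule tendsto_mult)
    then show "((\<lambda>q. s (fst q) * p (snd q)) \<longlongrightarrow> 0) (sequentially \<times>\<^sub>F nhds z)" by simp
    show "\<forall>\<^sub>F q in sequentially \<times>\<^sub>F nhds z. norm (s (fst q) * (p (snd q) * g (fst q) (snd q)))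
         \<le> norm (s (fst q) * p (snd q)) * M"
      using assms(2) by (auto simp: abs_mult mult.assoc intro!: always_eventually mult_left_mono)
  qed
  then show ?thesis by simp
qed

text \<open>The shape of the expression is chosen to be closed under differentiation. The derivative
  in direction v either falls on \<open>p\<close>, or it replaces \<eta> by its derivative and
  yields the factor a n * 2 (z \<bullet> v), of which \<open>a n\<close> is absorbed by
  \<open>s\<close> and 2 (z \<bullet> v) by \<open>p\<close>. The decay of \<open>s\<close> against
  all powers of \<open>a\<close> survives this exchange.\<close>

lemma Ck_lim_null:
  fixes p :: "'e::euclidean_space \<Rightarrow> real"
  assumes "smooth_on UNIV p" "smooth_on UNIV \<eta>" "\<And>vs. \<exists>M. \<forall>t. \<bar>iter_deriv vs \<eta> t\<bar> \<le> M"
    and "\<And>j. (\<lambda>n. s n * a n ^ j) \<longlonglongrightarrow> 0"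
  shows "Ck_lim k UNIV (\<lambda>n z. s n * (p z * \<eta> (a n * (z \<bullet> z) - b n))) (\<lambda>z. 0)"
  using assms
proof (induction k arbitrary: p \<eta> s)
  case (0 p \<eta> s)
  obtain M where "\<bar>\<eta> t\<bar> \<le> M" for t using 0(3)[of "[]"] by auto
  then show ?case using 0(4)[of 0] by (intro Ck_lim_0_null 0) auto
next
  case (Suc k p \<eta> s)
  obtain M where "\<bar>\<eta> t\<bar> \<le> M" for t using Suc.prems(3)[of "[]"] by auto
  then have 0: "Ck_lim 0 UNIV (\<lambda>n z. s n * (p z * \<eta> (a n * (z \<bullet> z) - b n))) (\<lambda>z. 0)"
    using Suc.prems(4)[of 0] by (intro Ck_lim_0_null Suc.prems) auto
  define \<eta>' where "\<eta>' = (\<lambda>t. frechet_derivative \<eta> (at t) 1)"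
  have \<eta>': "(\<eta> has_derivative (\<lambda>h. h * \<eta>' t)) (at t)" for t
  proof -
    have d: "(\<eta> has_derivative frechet_derivative \<eta> (at t)) (at t)"
      using smooth_on_derivative[OF Suc.prems(2)] by simp
    have "frechet_derivative \<eta> (at t) h = h * \<eta>' t" for h
      using linear_scale[OF has_derivative_linear[OF d], of h 1] by (simp add: \<eta>'_def)
    with d show ?thesis by (metis (no_types, lifting) ext)
  qed
  show ?case
  proof (rule Ck_lim_SucI[OF open_UNIV 0])
    fix n and z :: 'e
    have "((\<lambda>z. a n * (z \<bullet> z) - b n) has_derivative (\<lambda>v. a n * (2 * (z \<bullet> v)))) (at z)"
      by (auto intro!: derivative_eq_intros simp: inner_commute)
    from has_derivative_compose[OF this \<eta>']
    have "((\<lambda>z. \<eta> (a n * (z \<bullet> z) - b n)) has_derivative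
        (\<lambda>v. a n * (2 * (z \<bullet> v)) * \<eta>' (a n * (z \<bullet> z) - b n))) (at z)" .
    from has_derivative_mult_right[OF has_derivative_mult[OF smooth_on_derivative[OF Suc.prems(1) UNIV_I] this]]
    show "((\<lambda>z. s n * (p z * \<eta> (a n * (z \<bullet> z) - b n))) has_derivative
        (\<lambda>v. s n * (frechet_derivative p (at z) v * \<eta> (a n * (z \<bullet> z) - b n)) +
          s n * a n * (p z * (2 * (z \<bullet> v)) * \<eta>' (a n * (z \<bullet> z) - b n)))) (at z)"
      by (rule has_derivative_eq_rhs) (auto simp: algebra_simps)
  next
    fix v :: 'e
    have "Ck_lim k UNIV (\<lambda>n z. s n * (frechet_derivative p (at z) v * \<eta> (a n * (z \<bullet> z) - b n))) (\<lambda>z. 0)"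
      by (intro Suc.IH smooth_on_frechet_derivative Suc.prems)
    moreover have "Ck_lim k UNIV (\<lambda>n z. s n * a n * (p z * (2 * (z \<bullet> v)) * \<eta>' (a n * (z \<bullet> z) - b n))) (\<lambda>z. 0)"
    proof (rule Suc.IH)
      have "bounded_linear (\<lambda>z. 2 * (z \<bullet> v))" by (intro bounded_linear_intros)
      then show "smooth_on UNIV (\<lambda>z. p z * (2 * (z \<bullet> v)))"
        by (intro smooth_on_real_mult Suc.prems smooth_on_bounded_linear)
      show "smooth_on UNIV \<eta>'"
        unfolding \<eta>'_def by (intro smooth_on_frechet_derivative Suc.prems)
      have "iter_deriv vs \<eta>' = iter_deriv (vs @ [1]) \<eta>" for vs
        by (simp add: iter_deriv_append \<eta>'_def)
      with Suc.prems(3) show "\<exists>M. \<forall>t. \<bar>iter_deriv vs \<eta>' t\<bar> \<le> M" for vs by simp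
      show "(\<lambda>n. s n * a n * a n ^ j) \<longlonglongrightarrow> 0" for j
        using Suc.prems(4)[of "Suc j"] by (simp add: mult.assoc)
    qed
    ultimately show "Ck_lim k UNIV (\<lambda>n z. s n * (frechet_derivative p (at z) v * \<eta> (a n * (z \<bullet> z) - b n)) +
          s n * a n * (p z * (2 * (z \<bullet> v)) * \<eta>' (a n * (z \<bullet> z) - b n))) (\<lambda>z. 0)"
      using Ck_lim_add[OF open_UNIV] by fastforce
  qed auto
qed

text \<open>The derivatives are again constant multiples of \<open>cis\<close>, so the claim is
  proved for c * cis with arbitrary c.\<close>

lemma smooth_on_cis: "smooth_on UNIV cis"
proof -
  have "Ck_lim k UNIV (\<lambda>n t. c * cis t) (\<lambda>t. c * cis t)" for k c
  proof (induction k arbitrary: c)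
    case 0
    have "((\<lambda>q::nat \<times> real. c * cis (snd q)) \<longlongrightarrow> c * cis t) (sequentially \<times>\<^sub>F nhds t)" for t
      by (intro tendsto_intros filterlim_snd)
    then show ?case by simp
  next
    case (Suc k)
    have d: "((\<lambda>t. c * cis t) has_derivative (\<lambda>v. v *\<^sub>R (c * \<i>) * cis t)) (at t)" for t
      by (auto intro!: derivative_eq_intros simp: scaleR_conv_of_real algebra_simps)
    show ?case
      by (rule Ck_lim_SucI[OF open_UNIV Ck_lim_mono[OF Suc] d d Suc]) auto
  qed
  from this[of _ 1] show ?thesis by (simp add: smooth_on_iff_Ck_lim)
qed

text \<open>The angle tends to 0 with all derivatives by \<open>Ck_lim_null\<close> with p = 1;
  composition with the smooth \<open>cis\<close> then gives the limit 1 for the rotation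
  factor.\<close>

lemma Ck_lim_twist:
  assumes "cutoff \<kappa>" "\<And>j. (\<lambda>n. s n * a n ^ j) \<longlonglongrightarrow> 0"
  shows "Ck_lim k UNIV (\<lambda>n z. cis (s n * \<kappa> (a n * (z \<bullet> z) - b n)) * z) (\<lambda>z::complex. z)"
proof -
  have "Ck_lim k UNIV (\<lambda>n z::complex. s n * (1 * \<kappa> (a n * (z \<bullet> z) - b n))) (\<lambda>z. 0)" for k
    using assms Ck_lim_const
    by (intro Ck_lim_null cutoff_iter_deriv_bounded) (auto simp: cutoff_def smooth_on_iff_Ck_lim)
  from Ck_lim_compose[OF open_UNIV smooth_on_imp_Ck_lim[OF smooth_on_cis] this, of k]
  have "Ck_lim k UNIV (\<lambda>n z::complex. cis (s n * \<kappa> (a n * (z \<bullet> z) - b n))) (\<lambda>z. 1)"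
    by simp
  from bounded_bilinear.Ck_lim[OF bounded_bilinear_mult open_UNIV this Ck_lim_id[OF open_UNIV]]
  show ?thesis by simp
qed

section \<open>Local statements along the tail of a sequence\<close>

lemma Ck_lim_shift:
  assumes "Ck_lim k U F f"
  shows "Ck_lim k U (\<lambda>n. F (n + N)) f"
  using assms
proof (induction k arbitrary: F f)
  case (0 F f)
  have "((\<lambda>p. F (fst p + N) (snd p)) \<longlongrightarrow> f z) (sequentially \<times>\<^sub>F nhds z)" if "z \<in> U" for z
  proof -
    have "filterlim (\<lambda>p. (fst p + N, snd p)) (sequentially \<times>\<^sub>F nhds z) (sequentially \<times>\<^sub>F nhds z)"
      by (intro filterlim_Pair filterlim_snd filterlim_compose[OF filterlim_add_const_nat_at_top filterlim_fst])
    from filterlim_compose[OF Ck_lim_tendsto[OF 0 that] this] show ?thesis by simp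
  qed
  then show ?case by simp
next
  case (Suc k F f)
  have "((\<lambda>p. F (fst p + N) (snd p)) \<longlongrightarrow> f z) (sequentially \<times>\<^sub>F nhds z)" if "z \<in> U" for z
  proof -
    have "filterlim (\<lambda>p. (fst p + N, snd p)) (sequentially \<times>\<^sub>F nhds z) (sequentially \<times>\<^sub>F nhds z)"
      by (intro filterlim_Pair filterlim_snd filterlim_compose[OF filterlim_add_const_nat_at_top filterlim_fst])
    from filterlim_compose[OF Ck_lim_tendsto[OF Suc.prems that] this] show ?thesis by simp
  qed
  then show ?case using Suc.prems by (auto intro!: Suc.IH)
qed

lemma eventually_sequentially_prod_nhdsD:
  assumes "eventually P (sequentially \<times>\<^sub>F nhds z)"
  obtains N V where "open V" "z \<in> V" "\<And>n y. n \<ge> N \<Longrightarrow> y \<in> V \<Longrightarrow> P (n, y)"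
  using assms unfolding eventually_prod_filter eventually_sequentially eventually_nhds by metis

lemma eventually_sequentially_prod_nhdsI:
  assumes "eventually (\<lambda>p. P (fst p + N) (snd p)) (sequentially \<times>\<^sub>F nhds z)"
  shows "eventually (\<lambda>p. P (fst p) (snd p)) (sequentially \<times>\<^sub>F nhds z)"
proof -
  obtain M V where "open V" "z \<in> V" "\<And>n y. n \<ge> M \<Longrightarrow> y \<in> V \<Longrightarrow> P (n + N) y"
    using eventually_sequentially_prod_nhdsD[OF assms] by (metis fst_conv snd_conv)
  moreover have "P n y" if "n \<ge> M + N" "y \<in> V" for n y
    using calculation(3)[of "n - N" y] that by simp
  ultimately show ?thesis
    unfolding eventually_prod_filter eventually_sequentially eventually_nhds
    by (auto intro!: exI[of _ "\<lambda>n. n \<ge> M + N"] exI[of _ "\<lambda>y. y \<in> V"])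
qed

text \<open>Each point has a neighbourhood with its own threshold; a finite subcover allows the
  maximum of the thresholds. The premise is relative to \<open>K\<close> because \<open>P\<close>
  will be meaningful only for points that come from \<open>K\<close>.\<close>

lemma compact_eventually_sequentially:
  assumes "compact K" "\<And>z. z \<in> K \<Longrightarrow> eventually (\<lambda>p. snd p \<in> K \<longrightarrow> P (fst p) (snd p)) (sequentially \<times>\<^sub>F nhds z)"
  shows "eventually (\<lambda>n. \<forall>z\<in>K. P n z) sequentially"
proof -
  have "\<exists>N V. open V \<and> z \<in> V \<and> (\<forall>n\<ge>N. \<forall>y\<in>V \<inter> K. P n y)" if "z \<in> K" for z
    using eventually_sequentially_prod_nhdsD[OF assms(2)[OF that]] by (metis IntE fst_conv snd_conv)
  then obtain N V where NV: "\<And>z. z \<in> K \<Longrightarrow> open (V z) \<and> z \<in> V z \<and> (\<forall>n\<ge>N z. \<forall>y\<in>V z \<inter> K. P n y)"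
    by metis
  obtain C where C: "C \<subseteq> K" "finite C" "K \<subseteq> (\<Union>z\<in>C. V z)"
    using compactE_image[OF assms(1), of K V] NV by blast
  have "\<forall>z\<in>K. P n z" if "n \<ge> Max (N ` C)" for n
  proof
    fix y assume "y \<in> K"
    with C obtain z where z: "z \<in> C" "y \<in> V z" by blast
    with C have "N z \<le> n" using that by (meson Max_ge dual_order.trans finite_imageI imageI)
    with NV z C \<open>y \<in> K\<close> show "P n y" by blast
  qed
  then show ?thesis unfolding eventually_sequentially by blast
qed

text \<open>A coordinate change \<open>h\<close> is defined only on \<open>W\<close>, and
  \<open>Ck_lim_compose\<close> needs all terms to map into \<open>W\<close>. Joint convergence
  guarantees this near \<open>z\<close> from some \<open>N\<close> on; the first \<open>N\<close>
  terms are discarded by the shift.\<close>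

lemma Ck_lim_compose_locally:
  fixes h :: "'f::euclidean_space \<Rightarrow> 'g::real_normed_vector"
    and F :: "nat \<Rightarrow> 'e::euclidean_space \<Rightarrow> 'f"
  assumes "\<And>k. Ck_lim k U F f" "open U" "z \<in> U" "smooth_on W h" "f z \<in> W"
  obtains N V where "open V" "z \<in> V" "V \<subseteq> U" "\<And>n y. n \<ge> N \<Longrightarrow> y \<in> V \<Longrightarrow> F n y \<in> W"
    "\<And>k. Ck_lim k V (\<lambda>n y. h (F (n + N) y)) (\<lambda>y. h (f y))"
proof -
  have "open W" using assms(4) by (simp add: smooth_on_def)
  have "eventually (\<lambda>p. F (fst p) (snd p) \<in> W) (sequentially \<times>\<^sub>F nhds z)"
    using topological_tendstoD[OF Ck_lim_tendsto[OF assms(1,3)] \<open>open W\<close> assms(5)] .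
  then obtain N V where NV: "open V" "z \<in> V" "\<And>n y. n \<ge> N \<Longrightarrow> y \<in> V \<Longrightarrow> F n y \<in> W"
    by (rule eventually_sequentially_prod_nhdsD) auto
  \<comment> \<open>The limit must map into \<open>W\<close> as well, so the neighbourhood is cut
    down to the preimage of \<open>W\<close> under \<open>f\<close>.\<close>
  have "continuous_on U f"
    using assms(1)[of "Suc 0"]
    by (auto intro!: continuous_at_imp_continuous_on differentiable_imp_continuous_within)
  then have "open (U \<inter> f -` W)" using assms(2) \<open>open W\<close> by (rule continuous_open_preimage)
  define V' where "V' = V \<inter> (U \<inter> f -` W)"
  have V': "open V'" "z \<in> V'" "V' \<subseteq> U"
    using NV assms \<open>open (U \<inter> f -` W)\<close> by (auto simp: V'_def)
  have "Ck_lim k V' (\<lambda>n y. h (F (n + N) y)) (\<lambda>y. h (f y))" for k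
    by (rule Ck_lim_compose[OF V'(1) smooth_on_imp_Ck_lim[OF assms(4)]
          Ck_lim_mono[OF Ck_lim_shift[OF assms(1)] le_refl V'(3)]])
       (use NV in \<open>auto simp: V'_def\<close>)
  then show ?thesis using that[of V' N] V' NV by (auto simp: V'_def)
qed

lemma exponential_beats_powers:
  "(\<lambda>n. c / 2 ^ (n + N) * (real (n + N) ^ m) ^ j) \<longlonglongrightarrow> 0"
proof -
  have "(\<lambda>n. real n ^ (m * j) / 2 ^ n) \<longlonglongrightarrow> 0"
    by real_asymp
  from LIMSEQ_ignore_initial_segment[OF tendsto_mult_right_zero[OF this, of c], of N]
  show ?thesis by (simp add: power_mult)
qed

section \<open>Diffeomorphisms supported in a coordinate disk\<close>

lemma is_chart_open_image:
  assumes "is_chart c" "open S" "S \<subseteq> cdom c"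
  shows "open (coord c ` S)"
proof -
  let ?I = "inv_into (cdom c) (coord c)"
  have "continuous_on (coord c ` cdom c) ?I" "open (coord c ` cdom c)"
    using assms(1) by (auto simp: is_chart_def homeomorphism_def)
  then have "open (coord c ` cdom c \<inter> ?I -` S)"
    using assms(2) by (intro continuous_open_preimage)
  also have "coord c ` cdom c \<inter> ?I -` S = coord c ` S"
    using assms(3) by (force simp: inv_coord[OF assms(1)])
  finally show ?thesis .
qed

lemma is_chart_continuous_on:
  "is_chart c \<Longrightarrow> continuous_on (cdom c) (coord c)"
  "is_chart c \<Longrightarrow> continuous_on (coord c ` cdom c) (inv_into (cdom c) (coord c))"
  by (auto simp: is_chart_def homeomorphism_def)

lemma coord_image_mem:
  assumes "is_chart c" "p \<in> cdom c" "S \<subseteq> cdom c" "coord c p \<in> coord c ` S"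
  shows "p \<in> S"
proof -
  obtain r where r: "r \<in> S" "coord c p = coord c r" using assms(4) by blast
  then have "p = r" using inv_coord[OF assms(1,2)] inv_coord[OF assms(1), of r] assms(3) by auto
  with r show ?thesis by simp
qed

lemma chart_rep_coord:
  assumes "is_chart c" "q \<in> cdom c"
  shows "chart_rep c d f (coord c q) = coord d (f q)"
  using assms by (simp add: chart_rep_def inv_coord)

lemma smooth_structure_is_chart: "smooth_structure A \<Longrightarrow> c \<in> A \<Longrightarrow> is_chart c"
  by (simp add: smooth_structure_def)

lemma smooth_structure_cover:
  assumes "smooth_structure A"
  obtains c where "c \<in> A" "q \<in> cdom c"
proof -
  have "q \<in> (\<Union>c\<in>A. cdom c)" using assms unfolding smooth_structure_def by blast
  with that show ?thesis by blast
qed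

lemma smooth_transition:
  assumes "smooth_structure A" "c \<in> A" "d \<in> A"
  shows "smooth_on (coord c ` (cdom c \<inter> cdom d)) (chart_rep c d id)"
proof -
  have "compatible c d" using assms unfolding smooth_structure_def by blast
  then show ?thesis by (simp add: compatible_def)
qed

lemma smooth_map_id: "smooth_structure A \<Longrightarrow> smooth_map A A id"
  by (simp add: smooth_map_def smooth_transition)

lemma smooth_map_derivative:
  assumes "smooth_structure A" "smooth_map A A f" "c \<in> A" "d \<in> A" "q \<in> cdom c" "f q \<in> cdom d"
  shows "(chart_rep c d f has_derivative frechet_derivative (chart_rep c d f) (at (coord c q))) (at (coord c q))"
  using assms by (intro smooth_on_derivative[of "coord c ` (cdom c \<inter> f -` cdom d)"]) (auto simp: smooth_map_def)

lemma chart_deriv_apply: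
  assumes "smooth_structure A" "smooth_map A A f" "c \<in> A" "d \<in> A" "q \<in> cdom c" "f q \<in> cdom d"
  shows "blinfun_apply (chart_deriv c d f q) = frechet_derivative (chart_rep c d f) (at (coord c q))"
  using has_derivative_bounded_linear[OF smooth_map_derivative[OF assms]]
  by (simp add: chart_deriv_def bounded_linear_Blinfun_apply)

text \<open>The intermediate chart cancels on the open set ?S, where the representative of the
  composite map is the composite of the representatives.\<close>

lemma chart_deriv_compose:
  assumes A: "smooth_structure A" and f: "smooth_map A A f" and g: "smooth_map A A g"
    and cde: "c \<in> A" "d \<in> A" "e \<in> A" and q: "q \<in> cdom c" "f q \<in> cdom d" "g (f q) \<in> cdom e"
  shows "chart_deriv d e g (f q) o\<^sub>L chart_deriv c d f q = chart_deriv c e (g \<circ> f) q"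
proof -
  let ?S = "coord c ` (cdom c \<inter> f -` cdom d)"
  have ch: "is_chart c" "is_chart d" using A cde by (auto simp: smooth_structure_is_chart)
  have "open ?S" using f cde by (simp add: smooth_map_def smooth_on_def)
  have pt: "chart_rep c d f (coord c q) = coord d (f q)" by (rule chart_rep_coord[OF ch(1) q(1)])
  have "(chart_rep d e g \<circ> chart_rep c d f has_derivative
      frechet_derivative (chart_rep d e g) (at (coord d (f q))) \<circ>
      frechet_derivative (chart_rep c d f) (at (coord c q))) (at (coord c q))"
    by (rule diff_chain_at[OF smooth_map_derivative[OF A f cde(1,2) q(1,2)]])
       (use smooth_map_derivative[OF A g cde(2,3) q(2,3)] pt in simp)
  then have D: "(chart_rep c e (g \<circ> f) has_derivative
      frechet_derivative (chart_rep d e g) (at (coord d (f q))) \<circ>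
      frechet_derivative (chart_rep c d f) (at (coord c q))) (at (coord c q))"
    by (rule has_derivative_transform_within_open[OF _ \<open>open ?S\<close>])
       (use q ch in \<open>auto simp: chart_rep_def inv_coord\<close>)
  show ?thesis
  proof (rule blinfun_eqI)
    fix v
    have "chart_deriv c e (g \<circ> f) q v = frechet_derivative (chart_rep c e (g \<circ> f)) (at (coord c q)) v"
      using has_derivative_bounded_linear[OF D]
      by (simp add: chart_deriv_def frechet_derivative_at[OF D, symmetric] bounded_linear_Blinfun_apply)
    then show "(chart_deriv d e g (f q) o\<^sub>L chart_deriv c d f q) v = chart_deriv c e (g \<circ> f) q v"
      using chart_deriv_apply[OF A f cde(1,2) q(1,2)] chart_deriv_apply[OF A g cde(2,3) q(2,3)]
      by (simp add: frechet_derivative_at[OF D, symmetric])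
  qed
qed

lemma bivector_push_id: "bivector_push id_blinfun P = P"
  by (intro blinfun_eqI) (simp add: bivector_push_apply blinfun_compose_id)

locale disk_in_surface =
  fixes A :: "('a::{t2_space,second_countable_topology}, complex) chart set"
    and x :: "('a, complex) chart" and B :: "'a set"
  assumes A: "smooth_structure A" and x: "x \<in> A"
    and B: "B \<subseteq> cdom x" "coord x ` B = cball 0 1"
begin

abbreviation "point \<equiv> inv_into (cdom x) (coord x)"

lemma x_chart: "is_chart x" using A x by (rule smooth_structure_is_chart)

lemma open_cdom: "c \<in> A \<Longrightarrow> open (cdom c)"
  using smooth_structure_is_chart[OF A] by (simp add: is_chart_def)

lemma point_coord: "q \<in> cdom x \<Longrightarrow> point (coord x q) = q"
  by (rule inv_coord[OF x_chart])

lemma coord_point: "z \<in> coord x ` cdom x \<Longrightarrow> coord x (point z) = z"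
  by (rule f_inv_into_f)

lemma point_in_cdom: "z \<in> coord x ` cdom x \<Longrightarrow> point z \<in> cdom x"
  by (rule inv_into_into)

lemma cball_subset: "cball 0 1 \<subseteq> coord x ` cdom x"
  using B by blast

lemma in_B_iff:
  assumes "q \<in> cdom x"
  shows "q \<in> B \<longleftrightarrow> norm (coord x q) \<le> 1"
proof
  assume "norm (coord x q) \<le> 1"
  then have "coord x q \<in> coord x ` B" using B by simp
  then obtain p where "p \<in> B" "coord x q = coord x p" by blast
  then show "q \<in> B" using point_coord[OF assms] point_coord[of p] B by auto
next
  assume "q \<in> B"
  then have "coord x q \<in> cball 0 1" using B by blast
  then show "norm (coord x q) \<le> 1" by simp
qed

section \<open>Transplanting maps of the disk to the surface\<close>

definition lift :: "(complex \<Rightarrow> complex) \<Rightarrow> 'a \<Rightarrow> 'a" where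
  "lift \<Phi> q = (if q \<in> B then point (\<Phi> (coord x q)) else q)"

text \<open>Preserving the norm keeps \<open>B\<close> and its complement invariant. Fixing
  everything from radius 1/2 on, well inside \<open>B\<close>, leaves room for an open collar on
  which the lift is the identity.\<close>

definition disk_map :: "(complex \<Rightarrow> complex) \<Rightarrow> bool" where
  "disk_map \<Phi> \<longleftrightarrow> smooth_on UNIV \<Phi> \<and> (\<forall>z. norm (\<Phi> z) = norm z) \<and> (\<forall>z. norm z \<ge> 1/2 \<longrightarrow> \<Phi> z = z)"

text \<open>The formula holds on the whole chart domain, not only on the closed set
  \<open>B\<close>, because the map is the identity outside the unit disk. An open domain is what
  differentiation requires.\<close>

lemma disk_map_coord:
  assumes "disk_map \<Phi>" "q \<in> cdom x"
  shows "lift \<Phi> q = point (\<Phi> (coord x q))" "\<Phi> (coord x q) \<in> coord x ` cdom x"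
    "lift \<Phi> q \<in> cdom x" "coord x (lift \<Phi> q) = \<Phi> (coord x q)"
proof -
  have *: "lift \<Phi> q = point (\<Phi> (coord x q)) \<and> \<Phi> (coord x q) \<in> coord x ` cdom x"
  proof (cases "q \<in> B")
    case True
    then show ?thesis
      using assms cball_subset in_B_iff[of q] by (auto simp: lift_def disk_map_def)
  next
    case False
    then have "\<Phi> (coord x q) = coord x q" using assms in_B_iff[of q] by (auto simp: disk_map_def)
    with False assms show ?thesis by (simp add: lift_def point_coord)
  qed
  then show "lift \<Phi> q = point (\<Phi> (coord x q))" "\<Phi> (coord x q) \<in> coord x ` cdom x"
    "lift \<Phi> q \<in> cdom x" "coord x (lift \<Phi> q) = \<Phi> (coord x q)"
    by (auto simp: coord_point point_in_cdom simp del: image_iff)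
qed

lemma lift_in_B_iff:
  assumes "disk_map \<Phi>"
  shows "lift \<Phi> q \<in> B \<longleftrightarrow> q \<in> B"
proof (cases "q \<in> cdom x")
  case True
  then show ?thesis
    using assms in_B_iff[of q] in_B_iff[of "lift \<Phi> q"] disk_map_coord[OF assms True]
    by (simp add: disk_map_def)
next
  case False
  then show ?thesis using B by (auto simp: lift_def)
qed

text \<open>As the image of a compact disk, it is closed in the Hausdorff surface. Its complement
  and the domain of \<open>x\<close> form the open cover used for all local arguments about
  lifts.\<close>

definition core :: "'a set" where "core = point ` cball 0 (1/2)"

lemma closed_core: "closed core"
proof -
  have "continuous_on (cball 0 (1/2)) point"
    by (rule continuous_on_subset[OF is_chart_continuous_on(2)[OF x_chart]])
       (use cball_subset in auto)
  then show ?thesis unfolding core_def by (intro compact_imp_closed compact_continuous_image) auto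
qed

lemma core_subset: "core \<subseteq> cdom x"
  unfolding core_def using cball_subset by (auto intro!: point_in_cdom)

lemma lift_outside_core:
  assumes "disk_map \<Phi>" "q \<notin> core"
  shows "lift \<Phi> q = q"
proof (cases "q \<in> B")
  case True
  then have "q \<in> cdom x" using B by blast
  then have "norm (coord x q) \<ge> 1/2"
    using assms(2) point_coord[of q] unfolding core_def
    by (metis dist_0_norm image_eqI linorder_le_cases mem_cball)
  then show ?thesis using assms(1) \<open>q \<in> cdom x\<close> by (simp add: lift_def disk_map_def point_coord)
qed (simp add: lift_def)

lemma continuous_lift:
  assumes "disk_map \<Phi>"
  shows "continuous_on UNIV (lift \<Phi>)"
proof -
  have "continuous_on UNIV \<Phi>"
    using assms smooth_on_derivative[of UNIV \<Phi>] unfolding disk_map_def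
    by (meson UNIV_I continuous_at_imp_continuous_on has_derivative_continuous)
  then have "continuous_on (cdom x) (\<lambda>q. \<Phi> (coord x q))"
    by (rule continuous_on_compose2[OF _ is_chart_continuous_on(1)[OF x_chart]]) simp
  then have "continuous_on (cdom x) (\<lambda>q. point (\<Phi> (coord x q)))"
    by (rule continuous_on_compose2[OF is_chart_continuous_on(2)[OF x_chart]])
       (use disk_map_coord(2)[OF assms] in blast)
  then have 1: "continuous_on (cdom x) (lift \<Phi>)"
    by (rule continuous_on_eq) (simp add: disk_map_coord[OF assms])
  have 2: "continuous_on (- core) (lift \<Phi>)"
    by (rule continuous_on_eq[OF continuous_on_id]) (simp add: lift_outside_core[OF assms])
  have "cdom x \<union> - core = UNIV" using core_subset by auto
  with continuous_on_open_Un[OF open_cdom[OF x] _ 1 2] closed_core show ?thesis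
    by (simp add: open_Compl)
qed

text \<open>Near points of the domain of \<open>x\<close> the representative is a coordinate change
  to \<open>x\<close>, then the map of the plane, then a coordinate change from \<open>x\<close>;
  away from \<open>core\<close> it is an ordinary coordinate change.\<close>

lemma smooth_map_lift:
  assumes "disk_map \<Phi>"
  shows "smooth_map A A (lift \<Phi>)"
  unfolding smooth_map_def
proof (intro conjI ballI)
  show "continuous_on UNIV (lift \<Phi>)" by (rule continuous_lift[OF assms])
  fix c d assume c: "c \<in> A" and d: "d \<in> A"
  have ch: "is_chart c" "is_chart d" using A c d by (auto simp: smooth_structure_is_chart)
  have opre: "open (lift \<Phi> -` cdom d)"
    using continuous_lift[OF assms] open_cdom[OF d] by (simp add: continuous_on_open_vimage)
  show "smooth_on (coord c ` (cdom c \<inter> lift \<Phi> -` cdom d)) (chart_rep c d (lift \<Phi>))"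
  proof (rule smooth_on_locally)
    fix z assume "z \<in> coord c ` (cdom c \<inter> lift \<Phi> -` cdom d)"
    then obtain q where q: "z = coord c q" "q \<in> cdom c" "lift \<Phi> q \<in> cdom d" by auto
    show "\<exists>V. z \<in> V \<and> V \<subseteq> coord c ` (cdom c \<inter> lift \<Phi> -` cdom d) \<and> smooth_on V (chart_rep c d (lift \<Phi>))"
    proof (cases "q \<in> cdom x")
      case True
      define S where "S = cdom c \<inter> cdom x \<inter> lift \<Phi> -` cdom d"
      have S: "open S" "q \<in> S" "S \<subseteq> cdom c"
        using q True by (auto simp: S_def intro!: open_Int opre open_cdom c x)
      have V: "open (coord c ` S)" by (rule is_chart_open_image[OF ch(1) S(1,3)])
      have 1: "smooth_on (coord c ` S) (chart_rep c x id)"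
        by (rule smooth_on_subset[OF smooth_transition[OF A c x] _ V]) (auto simp: S_def)
      have 2: "smooth_on (coord c ` S) (\<lambda>y. \<Phi> (chart_rep c x id y))"
        using assms by (intro smooth_on_compose[OF 1]) (auto simp: disk_map_def)
      have "smooth_on (coord c ` S) (\<lambda>y. chart_rep x d id (\<Phi> (chart_rep c x id y)))"
      proof (rule smooth_on_compose[OF 2 smooth_transition[OF A x d]])
        show "(\<lambda>y. \<Phi> (chart_rep c x id y)) ` coord c ` S \<subseteq> coord x ` (cdom x \<inter> cdom d)"
        proof safe
          fix p assume p: "p \<in> S"
          then have "\<Phi> (chart_rep c x id (coord c p)) = coord x (lift \<Phi> p)"
            by (simp add: S_def chart_rep_coord[OF ch(1)] disk_map_coord(4)[OF assms])
          then show "\<Phi> (chart_rep c x id (coord c p)) \<in> coord x ` (cdom x \<inter> cdom d)"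
            using p disk_map_coord(3)[OF assms] by (auto simp: S_def)
        qed
      qed
      then have "smooth_on (coord c ` S) (chart_rep c d (lift \<Phi>))"
        by (rule smooth_on_cong)
           (auto simp: S_def chart_rep_def inv_coord[OF ch(1)] disk_map_coord(1)[OF assms])
      with S q show ?thesis by (intro exI[of _ "coord c ` S"]) (auto simp: S_def)
    next
      case False
      define S where "S = cdom c \<inter> - core \<inter> cdom d"
      have "q \<notin> core" using False core_subset by auto
      then have S: "open S" "q \<in> S" "S \<subseteq> cdom c"
        using q lift_outside_core[OF assms \<open>q \<notin> core\<close>]
        by (auto simp: S_def intro!: open_Int open_cdom c d open_Compl closed_core)
      have V: "open (coord c ` S)" by (rule is_chart_open_image[OF ch(1) S(1,3)])
      have "smooth_on (coord c ` S) (chart_rep c d id)"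
        by (rule smooth_on_subset[OF smooth_transition[OF A c d] _ V]) (auto simp: S_def)
      then have "smooth_on (coord c ` S) (chart_rep c d (lift \<Phi>))"
        by (rule smooth_on_cong)
           (auto simp: S_def chart_rep_def inv_coord[OF ch(1)] lift_outside_core[OF assms])
      with S q show ?thesis
        by (intro exI[of _ "coord c ` S"]) (auto simp: S_def lift_outside_core[OF assms])
    qed
  qed
qed

lemma lift_Diff:
  assumes "disk_map \<Phi>" "disk_map \<Psi>" "\<And>z. \<Psi> (\<Phi> z) = z" "\<And>z. \<Phi> (\<Psi> z) = z"
  shows "lift \<Phi> \<in> Diff A"
proof -
  have 1: "lift F (lift G q) = q" if "disk_map F" "disk_map G" "\<And>z. F (G z) = z" for F G q
  proof (cases "q \<in> cdom x")
    case True
    then show ?thesis using that disk_map_coord[OF that(2) True] disk_map_coord[OF that(1)]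
      by (simp add: point_coord)
  next
    case False
    then show ?thesis using B by (auto simp: lift_def)
  qed
  have "lift \<Phi> \<circ> lift \<Psi> = id" "lift \<Psi> \<circ> lift \<Phi> = id"
    using 1[OF assms(1,2)] 1[OF assms(2,1)] assms(3,4) by (auto simp: fun_eq_iff)
  then have "bij (lift \<Phi>)" "inv (lift \<Phi>) = lift \<Psi>"
    by (auto intro: o_bij inv_unique_comp)
  then show ?thesis using smooth_map_lift[OF assms(1)] smooth_map_lift[OF assms(2)] by (simp add: Diff_def)
qed

text \<open>The case distinction is that of \<open>smooth_map_lift\<close>. The number
  \<open>N\<close> is needed only in the chart domain of \<open>x\<close>, where the lifted map may
  leave the domain of \<open>d\<close> for small indices; outside it the lifts are locally the
  identity and N = 0 works.\<close>

lemma chart_rep_lift_Ck_lim: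
  assumes "\<And>n. disk_map (\<Phi> n)" "\<And>k. Ck_lim k UNIV \<Phi> (\<lambda>z. z)"
    and c: "c \<in> A" and d: "d \<in> A" and q: "q \<in> cdom c" "q \<in> cdom d"
  obtains N V where "open V" "coord c q \<in> V"
    "\<And>n p. n \<ge> N \<Longrightarrow> p \<in> cdom c \<Longrightarrow> coord c p \<in> V \<Longrightarrow> lift (\<Phi> n) p \<in> cdom d"
    "\<And>k. Ck_lim k V (\<lambda>n. chart_rep c d (lift (\<Phi> (n + N)))) (chart_rep c d id)"
proof -
  have ch: "is_chart c" using A c by (auto simp: smooth_structure_is_chart)
  show ?thesis
  proof (cases "q \<in> cdom x")
    case True
    let ?S = "cdom c \<inter> cdom x"
    let ?U = "coord c ` ?S"
    have U: "open ?U" by (intro is_chart_open_image[OF ch] open_Int open_cdom c x) auto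
    have *: "Ck_lim k ?U (\<lambda>n y. \<Phi> n (chart_rep c x id y)) (\<lambda>y. chart_rep c x id y)" for k
      by (rule Ck_lim_compose[OF U assms(2) smooth_on_imp_Ck_lim[OF smooth_transition[OF A c x]]]) auto
    have qU: "coord c q \<in> ?U" using q True by auto
    have "chart_rep c x id (coord c q) \<in> coord x ` (cdom x \<inter> cdom d)"
      using q True by (auto simp: chart_rep_coord[OF ch])
    then obtain N V where V: "open V" "coord c q \<in> V" "V \<subseteq> ?U"
      and NV: "\<And>n y. n \<ge> N \<Longrightarrow> y \<in> V \<Longrightarrow> \<Phi> n (chart_rep c x id y) \<in> coord x ` (cdom x \<inter> cdom d)"
      and lim: "\<And>k. Ck_lim k V (\<lambda>n y. chart_rep x d id (\<Phi> (n + N) (chart_rep c x id y)))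
        (\<lambda>y. chart_rep x d id (chart_rep c x id y))"
      by (rule Ck_lim_compose_locally[OF * U qU smooth_transition[OF A x d]]) blast
    have in_x: "p \<in> cdom x" if p: "p \<in> cdom c" "coord c p \<in> V" for p
    proof -
      have "coord c p \<in> ?U" using p V(3) by blast
      from coord_image_mem[OF ch p(1) _ this] show ?thesis by blast
    qed
    show ?thesis
    proof (rule that[of V N])
      fix n p assume n: "n \<ge> N" and p: "p \<in> cdom c" "coord c p \<in> V"
      have "\<Phi> n (chart_rep c x id (coord c p)) = coord x (lift (\<Phi> n) p)"
        using p in_x by (simp add: chart_rep_coord[OF ch] disk_map_coord(4)[OF assms(1)])
      then have "coord x (lift (\<Phi> n) p) \<in> coord x ` (cdom x \<inter> cdom d)"
        using NV[OF n p(2)] by (simp only:)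
      from coord_image_mem[OF x_chart disk_map_coord(3)[OF assms(1) in_x[OF p]] _ this]
      show "lift (\<Phi> n) p \<in> cdom d" by blast
    next
      fix k
      show "Ck_lim k V (\<lambda>n. chart_rep c d (lift (\<Phi> (n + N)))) (chart_rep c d id)"
      proof (rule Ck_lim_cong[OF V(1) lim])
        fix n y assume "y \<in> V"
        then obtain p where p: "y = coord c p" "p \<in> cdom c" "p \<in> cdom x" using V(3) by auto
        then show "chart_rep x d id (\<Phi> (n + N) (chart_rep c x id y)) = chart_rep c d (lift (\<Phi> (n + N))) y"
          by (simp add: chart_rep_def inv_coord[OF ch] disk_map_coord(1)[OF assms(1)])
      next
        fix y assume "y \<in> V"
        then obtain p where p: "y = coord c p" "p \<in> cdom c" "p \<in> cdom x" using V(3) by auto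
        then show "chart_rep x d id (chart_rep c x id y) = chart_rep c d id y"
          by (simp add: chart_rep_def inv_coord[OF ch] point_coord)
      qed
    qed (use V in auto)
  next
    case False
    define S where "S = cdom c \<inter> - core \<inter> cdom d"
    have S: "open S" "q \<in> S" "S \<subseteq> cdom c"
      using q core_subset False by (auto simp: S_def intro!: open_Int open_cdom c d open_Compl closed_core)
    have V: "open (coord c ` S)" by (rule is_chart_open_image[OF ch S(1,3)])
    show ?thesis
    proof (rule that[of "coord c ` S" 0])
      fix n p assume "p \<in> cdom c" "coord c p \<in> coord c ` S"
      then have "p \<in> S" by (intro coord_image_mem[OF ch _ S(3)])
      then show "lift (\<Phi> n) p \<in> cdom d" by (simp add: S_def lift_outside_core[OF assms(1)])
    next
      fix k
      have "smooth_on (coord c ` S) (chart_rep c d id)"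
        by (rule smooth_on_subset[OF smooth_transition[OF A c d] _ V]) (auto simp: S_def)
      from smooth_on_imp_Ck_lim[OF this]
      show "Ck_lim k (coord c ` S) (\<lambda>n. chart_rep c d (lift (\<Phi> (n + 0)))) (chart_rep c d id)"
        by (rule Ck_lim_cong[OF V])
           (auto simp: S_def chart_rep_def inv_coord[OF ch] lift_outside_core[OF assms(1)])
    qed (use S V in auto)
  qed
qed

text \<open>The neighbourhood is centred at \<open>f\<close> and merely contains the identity. Its
  strict inequalities hold for the identity at each point of \<open>K\<close>, hence for the lifts
  near that point and from some index on; compactness of \<open>K\<close> and finiteness of the set
  of derivative directions make this uniform.\<close>

lemma lift_eventually_Cinf_nbhd:
  assumes "\<And>n. disk_map (\<Phi> n)" "\<And>k. Ck_lim k UNIV \<Phi> (\<lambda>z. z)"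
    and f: "smooth_map A A f" and c: "c \<in> A" and d: "d \<in> A"
    and K: "compact K" "K \<subseteq> cdom c" "f ` K \<subseteq> cdom d" and id: "id \<in> Cinf_nbhd A A f c d K r \<epsilon>"
  shows "eventually (\<lambda>n. lift (\<Phi> n) \<in> Cinf_nbhd A A f c d K r \<epsilon>) sequentially"
proof -
  have ch: "is_chart c" using A c by (auto simp: smooth_structure_is_chart)
  define L :: "complex list set" where "L = {vs. set vs \<subseteq> Basis \<and> length vs \<le> r}"
  have "finite L" unfolding L_def by (rule finite_lists_length_le) simp
  define P where "P n z \<longleftrightarrow> lift (\<Phi> n) (inv_into (cdom c) (coord c) z) \<in> cdom d \<and>
    (\<forall>vs\<in>L. norm (iter_deriv vs (chart_rep c d f) z - iter_deriv vs (chart_rep c d (lift (\<Phi> n))) z) < \<epsilon>)" for n z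
  have "eventually (\<lambda>n. \<forall>z\<in>coord c ` K. P n z) sequentially"
  proof (rule compact_eventually_sequentially)
    show "compact (coord c ` K)"
      by (rule compact_continuous_image[OF continuous_on_subset[OF is_chart_continuous_on(1)[OF ch] K(2)] K(1)])
    fix z assume "z \<in> coord c ` K"
    then obtain q where q: "z = coord c q" "q \<in> K" by auto
    have "id ` K \<subseteq> cdom d" using id unfolding Cinf_nbhd_def by blast
    then have qcd: "q \<in> cdom c" "q \<in> cdom d" "f q \<in> cdom d" using q(2) K by auto
    obtain N V where V: "open V" "coord c q \<in> V"
      and NV: "\<And>n p. n \<ge> N \<Longrightarrow> p \<in> cdom c \<Longrightarrow> coord c p \<in> V \<Longrightarrow> lift (\<Phi> n) p \<in> cdom d"
      and lim: "\<And>k. Ck_lim k V (\<lambda>n. chart_rep c d (lift (\<Phi> (n + N)))) (chart_rep c d id)"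
      by (rule chart_rep_lift_Ck_lim[OF assms(1,2) c d qcd(1,2)]) blast
    have 1: "eventually (\<lambda>p. norm (iter_deriv vs (chart_rep c d f) (snd p) -
        iter_deriv vs (chart_rep c d (lift (\<Phi> (fst p + N)))) (snd p)) < \<epsilon>) (sequentially \<times>\<^sub>F nhds z)"
      if "vs \<in> L" for vs
    proof -
      have "Ck_lim 0 V (\<lambda>n. iter_deriv vs (chart_rep c d (lift (\<Phi> (n + N))))) (iter_deriv vs (chart_rep c d id))"
        by (rule Ck_lim_iter_deriv[OF lim])
      from Ck_lim_tendsto[OF this V(2)]
      have t1: "((\<lambda>p. iter_deriv vs (chart_rep c d (lift (\<Phi> (fst p + N)))) (snd p)) \<longlongrightarrow>
          iter_deriv vs (chart_rep c d id) z) (sequentially \<times>\<^sub>F nhds z)"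
        by (simp only: q(1))
      have "smooth_on (coord c ` (cdom c \<inter> f -` cdom d)) (chart_rep c d f)"
        using f c d by (simp add: smooth_map_def)
      from smooth_on_imp_Ck_lim[OF this]
      have "Ck_lim 0 (coord c ` (cdom c \<inter> f -` cdom d)) (\<lambda>n. iter_deriv vs (chart_rep c d f))
          (iter_deriv vs (chart_rep c d f))" by (rule Ck_lim_iter_deriv)
      moreover have "z \<in> coord c ` (cdom c \<inter> f -` cdom d)" using qcd q by blast
      ultimately have t2: "((\<lambda>p::nat \<times> complex. iter_deriv vs (chart_rep c d f) (snd p)) \<longlongrightarrow>
          iter_deriv vs (chart_rep c d f) z) (sequentially \<times>\<^sub>F nhds z)"
        by (rule Ck_lim_tendsto)
      \<comment> \<open>This strict inequality at the limit is what the two convergences carry over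
        to nearby points and late indices.\<close>
      have "norm (iter_deriv vs (chart_rep c d f) z - iter_deriv vs (chart_rep c d id) z) < \<epsilon>"
        using id that \<open>z \<in> coord c ` K\<close> unfolding Cinf_nbhd_def L_def by blast
      from order_tendstoD(2)[OF tendsto_norm[OF tendsto_diff[OF t2 t1]] this] show ?thesis .
    qed
    have 2: "eventually (\<lambda>p. snd p \<in> V) (sequentially \<times>\<^sub>F nhds z)"
      using V q by (intro eventually_sequentially_prod_nhds) auto
    have 3: "eventually (\<lambda>p. \<forall>vs\<in>L. norm (iter_deriv vs (chart_rep c d f) (snd p) -
        iter_deriv vs (chart_rep c d (lift (\<Phi> (fst p + N)))) (snd p)) < \<epsilon>) (sequentially \<times>\<^sub>F nhds z)"
      using \<open>finite L\<close> 1 by (intro eventually_ball_finite) auto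
    have "eventually (\<lambda>p. snd p \<in> coord c ` K \<longrightarrow> P (fst p + N) (snd p)) (sequentially \<times>\<^sub>F nhds z)"
      using 2 3
    proof eventually_elim
      case (elim p)
      show ?case
      proof
        assume "snd p \<in> coord c ` K"
        then obtain r where r: "snd p = coord c r" "r \<in> K" by auto
        then have "r \<in> cdom c" using K by auto
        then have "lift (\<Phi> (fst p + N)) (inv_into (cdom c) (coord c) (snd p)) \<in> cdom d"
          using elim(1) r(1) NV[of "fst p + N" r] inv_coord[OF ch] by simp
        with elim(2) show "P (fst p + N) (snd p)" unfolding P_def by blast
      qed
    qed
    then show "eventually (\<lambda>p. snd p \<in> coord c ` K \<longrightarrow> P (fst p) (snd p)) (sequentially \<times>\<^sub>F nhds z)"
      by (rule eventually_sequentially_prod_nhdsI[where P = "\<lambda>n y. y \<in> coord c ` K \<longrightarrow> P n y"])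
  qed
  then show ?thesis
  proof eventually_elim
    case (elim n)
    have "lift (\<Phi> n) q \<in> cdom d" if "q \<in> K" for q
    proof -
      have "P n (coord c q)" using elim that by blast
      then show ?thesis using inv_coord[OF ch, of q] K(2) that by (auto simp: P_def)
    qed
    moreover have "norm (iter_deriv vs (chart_rep c d f) z - iter_deriv vs (chart_rep c d (lift (\<Phi> n))) z) < \<epsilon>"
      if "set vs \<subseteq> Basis \<and> length vs \<le> r" "z \<in> coord c ` K" for vs z
      using elim that unfolding P_def L_def by blast
    ultimately show ?case
      using smooth_map_lift[OF assms(1)] unfolding Cinf_nbhd_def by blast
  qed
qed

text \<open>The property of containing almost all lifts once the identity is contained passes to
  finite intersections and to unions, so subbasic sets suffice.\<close>

lemma lift_eventually_open:
  assumes "\<And>n. disk_map (\<Phi> n)" "\<And>k. Ck_lim k UNIV \<Phi> (\<lambda>z. z)"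
    and "openin (Cinf_topology A A) W" "id \<in> W"
  shows "eventually (\<lambda>n. lift (\<Phi> n) \<in> W) sequentially"
proof -
  let ?B = "{Cinf_nbhd A A f c d K r \<epsilon> | f c d K r \<epsilon>.
        smooth_map A A f \<and> c \<in> A \<and> d \<in> A \<and> compact K \<and> K \<subseteq> cdom c \<and> f ` K \<subseteq> cdom d \<and> \<epsilon> > 0}"
  have "generate_topology_on ?B W"
    using assms(3) unfolding Cinf_topology_def by (simp only: openin_topology_generated_by_iff)
  then show ?thesis using assms(4)
  proof induction
    case (Int a b)
    then show ?case by (auto intro: eventually_conj)
  next
    case (UN K)
    then obtain k where "k \<in> K" "id \<in> k" by blast
    from UN.IH[OF this] \<open>k \<in> K\<close> show ?case by (auto elim: eventually_mono)
  next
    case (Basis s)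
    then obtain f c d K r \<epsilon> where "s = Cinf_nbhd A A f c d K r \<epsilon>" "smooth_map A A f" "c \<in> A" "d \<in> A"
      "compact K" "K \<subseteq> cdom c" "f ` K \<subseteq> cdom d" by blast
    then show ?case using lift_eventually_Cinf_nbhd[OF assms(1,2)] Basis.prems by blast
  qed simp
qed

lemma openin_Cinf_nbhd:
  assumes "smooth_map A A f" "c \<in> A" "d \<in> A" "compact K" "K \<subseteq> cdom c" "f ` K \<subseteq> cdom d" "\<epsilon> > 0"
  shows "openin (Cinf_topology A A) (Cinf_nbhd A A f c d K r \<epsilon>)"
  unfolding Cinf_topology_def using assms by (intro topology_generated_by_Basis) blast

lemma topspace_Cinf: "smooth_map A A f \<Longrightarrow> f \<in> topspace (Cinf_topology A A)"
proof -
  assume f: "smooth_map A A f"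
  have "f \<in> Cinf_nbhd A A f x x {} 0 1" using f by (simp add: Cinf_nbhd_def)
  moreover have "openin (Cinf_topology A A) (Cinf_nbhd A A f x x {} 0 1)"
    using f x by (intro openin_Cinf_nbhd) auto
  ultimately show ?thesis using openin_subset by blast
qed

text \<open>Continuity of evaluation at a point: the subbasic set of order 0 with K = {q} confines g
  q to a ball in a chart around f q.\<close>

lemma openin_evaluation:
  assumes "open V"
  shows "openin (Cinf_topology A A) {f. smooth_map A A f \<and> f q \<in> V}"
proof (subst openin_subopen, safe)
  fix f assume f: "smooth_map A A f" "f q \<in> V"
  obtain c where c: "c \<in> A" "q \<in> cdom c" using smooth_structure_cover[OF A] .
  obtain d where d: "d \<in> A" "f q \<in> cdom d" using smooth_structure_cover[OF A] .
  have ch: "is_chart c" "is_chart d" using A c d by (auto simp: smooth_structure_is_chart)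
  have "open (coord d ` (cdom d \<inter> V))"
    using d assms by (intro is_chart_open_image[OF ch(2)] open_Int open_cdom) auto
  then obtain e where e: "e > 0" "ball (coord d (f q)) e \<subseteq> coord d ` (cdom d \<inter> V)"
    using d f open_contains_ball by blast
  let ?W = "Cinf_nbhd A A f c d {q} 0 e"
  have "openin (Cinf_topology A A) ?W"
    using f(1) c d e(1) by (intro openin_Cinf_nbhd) auto
  moreover have "f \<in> ?W" using f d e by (auto simp: Cinf_nbhd_def)
  moreover have "?W \<subseteq> {f. smooth_map A A f \<and> f q \<in> V}"
  proof
    fix g assume g: "g \<in> ?W"
    then have "norm (coord d (f q) - coord d (g q)) < e" "g q \<in> cdom d"
      by (auto simp: Cinf_nbhd_def chart_rep_coord[OF ch(1) c(2)])
    then have "coord d (g q) \<in> coord d ` (cdom d \<inter> V)"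
      using e(2) by (auto simp: dist_norm)
    then have "g q \<in> V"
      using coord_image_mem[OF ch(2) \<open>g q \<in> cdom d\<close>, of "cdom d \<inter> V"] by blast
    then show "g \<in> {f. smooth_map A A f \<and> f q \<in> V}" using g by (simp add: Cinf_nbhd_def)
  qed
  ultimately show "\<exists>T. openin (Cinf_topology A A) T \<and> f \<in> T \<and> T \<subseteq> {f. smooth_map A A f \<and> f q \<in> V}"
    by blast
qed

end

section \<open>The rings of disks\<close>

abbreviation disk :: "nat \<Rightarrow> nat \<Rightarrow> complex set" where
  "disk n s \<equiv> ball (centre n s) (disk_radius n)"

definition ring_sum :: "(real \<Rightarrow> real) \<Rightarrow> nat \<Rightarrow> complex \<Rightarrow> real" where
  "ring_sum \<kappa> n z = (\<Sum>s=1..2^n. \<kappa> (norm (z - centre n s) / disk_radius n))"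

definition density :: "(real \<Rightarrow> real) \<Rightarrow> complex \<Rightarrow> real" where
  "density \<kappa> z = (\<Sum>n. ring_sum \<kappa> (n + 4) z / fact (n + 4))"

text \<open>Pairing with the two coordinate forms extracts the scalar coefficient of a multiple of
  this bivector; summability and non-vanishing thereby reduce to real numbers.\<close>

lemma wedge_1_i_apply: "wedge 1 \<i> (Blinfun Re) (Blinfun Im) = 1"
  by (simp add: wedge_apply bounded_linear_Blinfun_apply bounded_linear_Re bounded_linear_Im)

lemma wedge_1_i_nonzero: "wedge 1 \<i> \<noteq> (0 :: complex bivector)"
  using wedge_1_i_apply by (metis blinfun.zero_left zero_neq_one)

lemma density_summable:
  assumes "cutoff \<kappa>"
  shows "summable (\<lambda>n. ring_sum \<kappa> (n + 4) z / fact (n + 4))"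
proof -
  have "summable (\<lambda>n. pi_ring \<kappa> (n + 4) z (Blinfun Re) (Blinfun Im))"
    using summable_ignore_initial_segment[OF summable_pi_ring[OF assms], of 4 z]
    by (intro bounded_linear.summable[OF blinfun.bounded_linear_left])
  then show ?thesis
    by (simp add: pi_ring_wedge blinfun.bilinear_simps wedge_1_i_apply ring_sum_def)
qed

lemma pi_series_density:
  assumes "cutoff \<kappa>"
  shows "pi_series \<kappa> z = density \<kappa> z *\<^sub>R wedge 1 \<i>"
proof -
  have "(\<Sum>n. (ring_sum \<kappa> (n + 4) z / fact (n + 4)) *\<^sub>R wedge 1 \<i>) = density \<kappa> z *\<^sub>R wedge 1 \<i>"
    unfolding density_def
    by (rule bounded_linear.suminf[OF bounded_linear_scaleR_left density_summable[OF assms], symmetric])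
  then show ?thesis by (simp add: pi_series_def pi_ring_wedge ring_sum_def)
qed

lemma disk_radius_pos: "n > 0 \<Longrightarrow> disk_radius n > 0"
  by (simp add: disk_radius_def)

lemma cutoff_pos_iff:
  assumes "cutoff \<kappa>"
  shows "0 < \<kappa> t \<longleftrightarrow> \<bar>t\<bar> < 1"
proof
  show "\<bar>t\<bar> < 1" if "0 < \<kappa> t"
    using assms that unfolding cutoff_def by (metis less_irrefl linorder_not_less)
  show "0 < \<kappa> t" if "\<bar>t\<bar> < 1"
    using assms that unfolding cutoff_def by (metis linorder_not_less zero_less_one)
qed

text \<open>All terms are nonnegative, so nothing cancels, and each term is positive exactly on its
  open disk.\<close>

lemma ring_sum_pos_iff:
  assumes "cutoff \<kappa>" "n > 0"
  shows "0 < ring_sum \<kappa> n z \<longleftrightarrow> (\<exists>s\<in>{1..2^n}. z \<in> disk n s)"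
proof -
  have nonneg: "0 \<le> \<kappa> t" for t using assms by (simp add: cutoff_def)
  have *: "0 < \<kappa> (norm (z - centre n s) / disk_radius n) \<longleftrightarrow> z \<in> disk n s" for s
    using disk_radius_pos[OF assms(2)]
    by (simp add: cutoff_pos_iff[OF assms(1)] dist_norm norm_minus_commute)
  have "ring_sum \<kappa> n z = 0 \<longleftrightarrow> (\<forall>s\<in>{1..2^n}. \<kappa> (norm (z - centre n s) / disk_radius n) = 0)"
    unfolding ring_sum_def by (intro sum_nonneg_eq_0_iff) (auto simp: nonneg)
  moreover have "0 \<le> ring_sum \<kappa> n z" unfolding ring_sum_def by (intro sum_nonneg nonneg)
  moreover have "\<kappa> t = 0 \<longleftrightarrow> \<not> 0 < \<kappa> t" for t using nonneg[of t] by auto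
  ultimately show ?thesis using * by (metis less_le)
qed

lemma ring_sum_nonneg: "cutoff \<kappa> \<Longrightarrow> 0 \<le> ring_sum \<kappa> n z"
  unfolding ring_sum_def by (intro sum_nonneg) (simp add: cutoff_def)

lemma density_nonzero_iff:
  assumes "cutoff \<kappa>"
  shows "density \<kappa> z \<noteq> 0 \<longleftrightarrow> (\<exists>n\<ge>4. \<exists>s\<in>{1..2^n}. z \<in> disk n s)"
proof -
  have nonneg: "0 \<le> ring_sum \<kappa> (n + 4) z / fact (n + 4)" for n
    using ring_sum_nonneg[OF assms] by simp
  have "density \<kappa> z = 0 \<longleftrightarrow> (\<forall>n. ring_sum \<kappa> (n + 4) z / fact (n + 4) = 0)"
    unfolding density_def by (rule suminf_eq_zero_iff[OF density_summable[OF assms] nonneg])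
  also have "\<dots> \<longleftrightarrow> (\<forall>n. \<not> 0 < ring_sum \<kappa> (n + 4) z)"
    using ring_sum_nonneg[OF assms] by (auto simp: order_le_less)
  also have "\<dots> \<longleftrightarrow> \<not> (\<exists>n\<ge>4. \<exists>s\<in>{1..2^n}. z \<in> disk n s)"
    by (auto simp: ring_sum_pos_iff[OF assms] le_iff_add add.commute)
  finally show ?thesis by blast
qed

section \<open>Separating one ring from all others\<close>

text \<open>
  Equals \<open>n\<^sup>2 ((n \<bar>z\<bar>)\<^sup>2 - 1)\<close>: a polynomial in place of the radius, which is not smooth at \<open>0\<close>.
\<close>

definition annulus :: "nat \<Rightarrow> complex \<Rightarrow> real" where
  "annulus n z = real n ^ 4 * (z \<bullet> z) - real n ^ 2"

lemma annulus_norm: "annulus n z = (real n)\<^sup>2 * ((real n * norm z)\<^sup>2 - 1)"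
  by (simp add: annulus_def dot_square_norm power_mult_distrib algebra_simps flip: power_add)

lemma centre_cis: "centre n s = of_real (1 / real n) * cis (2 * pi * real s / 2 ^ n)"
  unfolding centre_def cis_conv_exp by (simp add: mult.commute)

lemma norm_centre: "norm (centre n s) = 1 / real n"
  by (simp add: centre_cis norm_divide)

lemma disk_norm:
  assumes "z \<in> disk n s" "n > 0"
  shows "\<bar>real n * norm z - 1\<bar> < 1 / 2 ^ n"
proof -
  have "\<bar>norm z - 1 / real n\<bar> < 1 / (real n * 2 ^ n)"
    using assms norm_triangle_ineq3[of z "centre n s"]
    by (simp add: norm_centre disk_radius_def dist_norm norm_minus_commute)
  then have "real n * \<bar>norm z - 1 / real n\<bar> < real n * (1 / (real n * 2 ^ n))"
    using assms(2) by (intro mult_strict_left_mono) auto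
  also have "real n * \<bar>norm z - 1 / real n\<bar> = \<bar>real n * norm z - 1\<bar>"
  proof -
    have "real n * norm z - 1 = real n * (norm z - 1 / real n)" using assms(2) by (simp add: field_simps)
    then show ?thesis by (simp add: abs_mult)
  qed
  finally show ?thesis using assms(2) by simp
qed

text \<open>The source of the bound 9: at n = 8 the inequality fails (384 against 256). The constant
  6 is 2 * 3, where 3 bounds n |z| + 1 on the ring and 2 turns the result into 1/2.\<close>

lemma six_squares_le_power: "9 \<le> n \<Longrightarrow> 6 * n\<^sup>2 \<le> 2 ^ n" for n :: nat
proof (induction n rule: nat_induct_at_least)
  case (Suc n)
  have "6 * (Suc n)\<^sup>2 = 6 * n\<^sup>2 + 12 * n + 6" by (simp add: power2_eq_square)
  moreover have "12 * n + 6 \<le> 6 * n\<^sup>2"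
  proof -
    have "12 * n + 6 \<le> 18 * n" using Suc by simp
    also have "\<dots> \<le> 6 * (n * n)" using Suc by simp
    finally show ?thesis by (simp add: power2_eq_square)
  qed
  ultimately show ?case unfolding power_Suc using Suc.IH by linarith
qed simp

lemma annulus_on_ring:
  assumes "z \<in> disk n s" "9 \<le> n"
  shows "\<bar>annulus n z\<bar> < 1/2"
proof -
  define u where "u = real n * norm z"
  define e :: real where "e = 1 / 2 ^ n"
  have u: "\<bar>u - 1\<bar> < e" "0 \<le> u" using disk_norm[OF assms(1)] assms(2) by (auto simp: u_def e_def)
  have e: "0 < e" "e \<le> 1" by (auto simp: e_def)
  have "real (6 * n\<^sup>2) \<le> real (2 ^ n)" using six_squares_le_power[OF assms(2)] by (rule of_nat_mono)
  then have en: "6 * (real n)\<^sup>2 * e \<le> 1" by (simp add: e_def)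
  have "\<bar>annulus n z\<bar> = (real n)\<^sup>2 * (\<bar>u - 1\<bar> * (u + 1))"
    using u(2) by (simp add: annulus_norm abs_mult power2_eq_square square_diff_one_factored flip: u_def)
  also have "\<dots> < (real n)\<^sup>2 * (e * 3)"
    using u e assms(2) by (intro mult_strict_left_mono mult_less_le_imp_less) auto
  finally show ?thesis using en by simp
qed

text \<open>In the scaled radius u = n |z| the other rings keep a distance of order 1/n from u = 1,
  and the factor n^2 in \<open>annulus\<close> turns this into a value above 1. Inner and outer
  rings are treated separately.\<close>

lemma annulus_off_ring:
  assumes "z \<in> disk m s" "4 \<le> m" "9 \<le> n" "m \<noteq> n"
  shows "1 < \<bar>annulus n z\<bar>"
proof -
  define w where "w = real m * norm z"
  define u where "u = real n * norm z"
  have w: "\<bar>w - 1\<bar> < 1 / 2 ^ m" using disk_norm[OF assms(1)] assms(2) by (auto simp: w_def)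
  have u0: "0 \<le> u" by (simp add: u_def)
  have um: "real m * u = real n * w" by (simp add: u_def w_def)
  have eq: "annulus n z = (real n)\<^sup>2 * (u\<^sup>2 - 1)" by (simp add: annulus_norm u_def)
  \<comment> \<open>Relative to its radius 1/m, a ring has half-width at most 1 / (2 (m + 1)), half
    of the relative distance to the next radius 1/(m + 1).\<close>
  have pm: "2 * (m + 1) \<le> 2 ^ m"
    using assms(2) by (induction m rule: nat_induct_at_least) auto
  then have "real (2 * (m + 1)) \<le> real (2 ^ m)" by (rule of_nat_mono)
  then have e: "1 / 2 ^ m \<le> 1 / (2 * (real m + 1))" by (intro divide_left_mono) auto
  show ?thesis
  proof (cases "n < m")
    case True
    define N where "N = real n"
    have N: "9 \<le> N" "N + 1 \<le> real m" using assms True by (auto simp: N_def)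
    have "w < 1 + 1 / (2 * (real m + 1))" using w e by linarith
    also have "\<dots> \<le> 1 + 1 / (2 * (N + 1))" using N by (intro add_left_mono divide_left_mono) auto
    finally have w1: "w < 1 + 1 / (2 * (N + 1))" .
    \<comment> \<open>Among the inner rings the nearest one, m = n + 1, is the worst case; m \<ge> N
      + 1 reduces to it.\<close>
    have "(N + 1) * u \<le> real m * u" using N u0 by (intro mult_right_mono)
    also have "\<dots> = N * w" by (simp add: um N_def)
    also have "\<dots> \<le> N * (1 + 1 / (2 * (N + 1)))" using N w1 by (intro mult_left_mono) auto
    also have "\<dots> \<le> N + 1/2" using N by (simp add: field_simps)
    finally have "(N + 1) * (1 - u) \<ge> 1/2" by (simp add: algebra_simps)
    then have u1: "1 - u \<ge> 1 / (2 * (N + 1))" using N by (simp add: field_simps)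
    then have "u \<le> 1" using N by (smt (verit) divide_nonneg_nonneg)
    then have "u\<^sup>2 \<le> u" using u0 by (simp add: power2_eq_square mult_left_le)
    then have "1 - u\<^sup>2 \<ge> 1 / (2 * (N + 1))" using u1 by linarith
    then have "N\<^sup>2 * (1 - u\<^sup>2) \<ge> N\<^sup>2 * (1 / (2 * (N + 1)))" by (intro mult_left_mono) auto
    moreover have "N\<^sup>2 * (1 / (2 * (N + 1))) > 1"
    proof -
      have "9 * N \<le> N\<^sup>2" using N by (simp add: power2_eq_square)
      moreover have "2 * (N + 1) < 9 * N" using N by simp
      ultimately have "2 * (N + 1) < N\<^sup>2" by (rule less_le_trans[rotated])
      then show ?thesis using N by (simp add: field_simps)
    qed
    ultimately have "1 < N\<^sup>2 * (1 - u\<^sup>2)" by linarith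
    moreover have "annulus n z = - (N\<^sup>2 * (1 - u\<^sup>2))" unfolding eq N_def by (simp add: algebra_simps)
    ultimately show ?thesis by simp
  next
    case False
    define M where "M = real m"
    have M: "4 \<le> M" "M + 1 \<le> real n" using assms False by (auto simp: M_def)
    have "1 - 1 / (2 * (M + 1)) < w" using w e unfolding M_def by linarith
    \<comment> \<open>For the outer rings the worst case is n = m + 1; now only the lower bound on
      \<open>w\<close> matters.\<close>
    have "M + 1/2 = (M + 1) * (1 - 1 / (2 * (M + 1)))" using M by (simp add: field_simps)
    also have "\<dots> \<le> (M + 1) * w" using M \<open>1 - 1 / (2 * (M + 1)) < w\<close> by (intro mult_left_mono) auto
    also have "\<dots> \<le> real n * w" using M by (intro mult_right_mono) (auto simp: w_def)
    also have "\<dots> = M * u" using um by (simp add: M_def)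
    finally have "M + 1/2 \<le> M * u" .
    then have u1: "1 + 1 / (2 * M) \<le> u" using M by (simp add: field_simps)
    then have "(1 + 1 / (2 * M))\<^sup>2 \<le> u\<^sup>2" using M by (intro power_mono) auto
    moreover have "(1 + 1 / (2 * M))\<^sup>2 \<ge> 1 + 1 / M" using M by (simp add: power2_eq_square field_simps)
    ultimately have "1 / M \<le> u\<^sup>2 - 1" by linarith
    moreover have "1 / real n \<le> 1 / M" using M by (intro divide_left_mono) auto
    ultimately have "1 / real n \<le> u\<^sup>2 - 1" by linarith
    then have "(real n)\<^sup>2 * (1 / real n) \<le> annulus n z" unfolding eq by (intro mult_left_mono) auto
    then have "real n \<le> annulus n z" using assms(3) by (simp add: power2_eq_square)
    then show ?thesis using assms(3) by linarith
  qed
qed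

lemma annulus_outside:
  assumes "norm z \<ge> 1/2" "9 \<le> n"
  shows "1 \<le> \<bar>annulus n z\<bar>"
proof -
  have n: "9 \<le> real n" using assms by simp
  have "2 \<le> real n * norm z" using mult_mono[of 9 "real n" "1/2" "norm z"] n assms by simp
  then have "2\<^sup>2 \<le> (real n * norm z)\<^sup>2" by (intro power_mono) auto
  moreover have "1 \<le> (real n)\<^sup>2" using n by simp
  ultimately have "1 * 1 \<le> (real n)\<^sup>2 * ((real n * norm z)\<^sup>2 - 1)" by (intro mult_mono) auto
  then show ?thesis by (simp add: annulus_norm)
qed

text \<open>The powers of \<omega> sum to 0, so N is the sum of the differences 1 - \<omega>^k for k
  < N. Each is at most k |1 - \<omega>| in norm, and these bounds add up to |1 - \<omega>| N (N - 1)
  / 2. This replaces a trigonometric estimate of the chord.\<close>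

lemma root_of_unity_gap:
  fixes \<omega> :: complex
  assumes "\<omega> ^ N = 1" "\<omega> \<noteq> 1" "N > 0"
  shows "2 \<le> real N * norm (1 - \<omega>)"
proof -
  have norm: "norm \<omega> = 1" using assms(1,3) by (metis norm_one norm_power power_eq_1_iff norm_ge_zero less_irrefl)
  have "(\<Sum>k<N. \<omega> ^ k) = 0" using assms by (simp add: geometric_sum)
  then have "of_nat N = (\<Sum>k<N. 1 - \<omega> ^ k)" by (simp add: sum_subtractf)
  then have "real N = norm (\<Sum>k<N. 1 - \<omega> ^ k)" by (metis norm_of_nat)
  also have "\<dots> \<le> (\<Sum>k<N. real k * norm (1 - \<omega>))"
  proof (rule sum_norm_le)
    fix k
    show "norm (1 - \<omega> ^ k) \<le> real k * norm (1 - \<omega>)"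
      using norm_power_diff[of 1 \<omega> k] norm by simp
  qed
  also have "\<dots> = real (\<Sum>k<N. k) * norm (1 - \<omega>)" by (simp add: sum_distrib_right)
  also have "2 * \<dots> = real (N * (N - 1)) * norm (1 - \<omega>)"
  proof -
    have "2 * (\<Sum>k<N. k) = N * (N - 1)" for N :: nat by (induction N) (auto simp: algebra_simps)
    then have "2 * real (\<Sum>k<N. k) = real (N * (N - 1))" by (metis of_nat_mult of_nat_numeral)
    then show ?thesis by simp
  qed
  finally have "2 * real N \<le> real (N * (N - 1)) * norm (1 - \<omega>)" by simp
  also have "\<dots> \<le> real (N * N) * norm (1 - \<omega>)" by (intro mult_right_mono of_nat_mono mult_left_mono) auto
  finally have "real N * 2 \<le> real N * (real N * norm (1 - \<omega>))" by (simp add: mult.assoc)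
  then show ?thesis using assms(3) by simp
qed

lemma centre_eq: "centre n s = of_real (1 / real n) * cis (2 * pi / 2 ^ n) ^ s"
  by (simp add: centre_cis Complex.DeMoivre mult_ac)

lemma centre_Suc: "centre n (Suc s) = cis (2 * pi / 2 ^ n) * centre n s"
  by (simp add: centre_eq)

lemma root_power_2n: "cis (2 * pi / 2 ^ n) ^ 2 ^ n = 1"
  by (simp add: Complex.DeMoivre)

text \<open>By the gap between roots of unity two centres are at least (1/n) (2 / 2^n) apart, which
  is precisely the sum of the two radii; the disks are open, so this is enough.\<close>

lemma disks_disjoint:
  assumes "s \<in> {1..2^n}" "t \<in> {1..2^n}" "s \<noteq> t" "n > 0"
  shows "disk n s \<inter> disk n t = {}"
proof -
  have *: "2 * disk_radius n \<le> dist (centre n s) (centre n t)" if "s < t" "t - s < 2 ^ n" for s t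
  proof -
    define \<omega> where "\<omega> = cis (2 * pi / 2 ^ n) ^ (t - s)"
    have "cis (2 * pi / 2 ^ n) ^ t = cis (2 * pi / 2 ^ n) ^ s * \<omega>"
      using that by (simp add: \<omega>_def flip: power_add)
    then have "centre n s - centre n t = of_real (1 / real n) * cis (2 * pi / 2 ^ n) ^ s * (1 - \<omega>)"
      by (simp add: centre_eq right_diff_distrib)
    then have "norm (centre n s - centre n t) = (1 / real n) * norm (1 - \<omega>)"
      by (simp add: norm_mult norm_power norm_divide)
    moreover have "2 \<le> real (2 ^ n) * norm (1 - \<omega>)"
    proof (rule root_of_unity_gap)
      show "\<omega> ^ 2 ^ n = 1"
        using root_power_2n[of n] by (metis \<omega>_def mult.commute power_mult power_one)
      have "\<omega> = cis (real (t - s) * (2 * pi / 2 ^ n))" by (simp only: \<omega>_def Complex.DeMoivre)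
      then have "\<omega> = exp (2 * of_real pi * \<i> * of_nat (t - s) / of_nat (2 ^ n))"
        unfolding cis_conv_exp by (simp only:) (intro arg_cong[where f = exp], simp add: mult_ac)
      then have "\<omega> = 1 \<longleftrightarrow> (2 ^ n) dvd (t - s)"
        using complex_root_unity_eq_1[of "2 ^ n" "t - s"] by simp
      then show "\<omega> \<noteq> 1" using that by (auto dest: dvd_imp_le)
    qed simp
    then have "2 / 2 ^ n / real n \<le> norm (1 - \<omega>) / real n"
      by (intro divide_right_mono) (simp_all add: field_simps)
    ultimately show ?thesis by (simp add: dist_norm disk_radius_def mult.commute)
  qed
  have "2 * disk_radius n \<le> dist (centre n s) (centre n t)"
  proof (cases "s < t")
    case True
    with *[of s t] assms show ?thesis by auto
  next
    case False
    with *[of t s] assms show ?thesis by (auto simp: dist_commute)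
  qed
  then show ?thesis by (intro disjoint_ballI) simp
qed

text \<open>The rotation moves each centre to the next, so it permutes the summands
  cyclically.\<close>

lemma ring_sum_rotate: "ring_sum \<kappa> n (cis (2 * pi / 2 ^ n) * z) = ring_sum \<kappa> n z"
proof -
  let ?\<omega> = "cis (2 * pi / 2 ^ n)"
  define g where "g s = \<kappa> (norm (z - centre n s) / disk_radius n)" for s
  have "norm (?\<omega> * z - centre n (Suc s)) = norm (z - centre n s)" for s
    by (simp add: centre_Suc norm_mult flip: right_diff_distrib)
  then have "ring_sum \<kappa> n (?\<omega> * z) = (\<Sum>s<2^n. g s)"
    unfolding ring_sum_def g_def
    by (simp add: sum.atLeast1_atMost_eq lessThan_atLeast0)
  also have "\<dots> = (\<Sum>s<2^n. g (Suc s))"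
  proof -
    \<comment> \<open>The ring closes up: the centres with indices 0 and 2^n coincide, which makes
      the sums over 0, ..., 2^n - 1 and 1, ..., 2^n equal.\<close>
    have "g (2 ^ n) = g 0" by (simp add: g_def centre_eq root_power_2n)
    then show ?thesis using sum.lessThan_Suc_shift[of g "2 ^ n"] by simp
  qed
  also have "\<dots> = ring_sum \<kappa> n z"
    unfolding ring_sum_def g_def by (simp add: sum.atLeast1_atMost_eq lessThan_atLeast0)
  finally show ?thesis .
qed

text \<open>The parameter \<sigma> is 1 for the map itself and -1 for its inverse: the angle depends
  on |z| alone, and a twist preserves |z|.\<close>

definition twist :: "(real \<Rightarrow> real) \<Rightarrow> real \<Rightarrow> nat \<Rightarrow> complex \<Rightarrow> complex" where
  "twist \<kappa> \<sigma> n z = cis (\<sigma> * (2 * pi / 2 ^ n) * \<kappa> (annulus n z)) * z"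

lemma norm_twist: "norm (twist \<kappa> \<sigma> n z) = norm z"
  by (simp add: twist_def norm_mult)

lemma annulus_twist: "annulus n (twist \<kappa> \<sigma> m z) = annulus n z"
  by (simp add: annulus_norm norm_twist)

lemma twist_inverse: "twist \<kappa> (-\<sigma>) n (twist \<kappa> \<sigma> n z) = z"
proof -
  have "twist \<kappa> (-\<sigma>) n (twist \<kappa> \<sigma> n z) =
      cis (-\<sigma> * (2 * pi / 2 ^ n) * \<kappa> (annulus n z)) * (cis (\<sigma> * (2 * pi / 2 ^ n) * \<kappa> (annulus n z)) * z)"
    unfolding twist_def[of _ "-\<sigma>"] annulus_twist by (simp add: twist_def)
  also have "\<dots> = z" by (simp add: cis_mult flip: mult.assoc)
  finally show ?thesis .
qed

text \<open>Instance of \<open>Ck_lim_twist\<close> with a n = (n + 9)^4 and b n = (n + 9)^2, the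
  coefficients of \<open>annulus\<close>; the angle decays like 2^(-n) and beats all powers of
  \<open>a\<close>.\<close>

lemma Ck_lim_twist_tail:
  assumes "cutoff \<kappa>"
  shows "Ck_lim k UNIV (\<lambda>n. twist \<kappa> \<sigma> (n + 9)) (\<lambda>z. z)"
proof -
  have "(\<lambda>n. \<sigma> * (2 * pi / 2 ^ (n + 9)) * (real (n + 9) ^ 4) ^ j) \<longlonglongrightarrow> 0" for j
    using exponential_beats_powers[of "\<sigma> * (2 * pi)" 9 4 j] by simp
  from Ck_lim_twist[OF assms this, of k "\<lambda>n. (real (n + 9))\<^sup>2"]
  show ?thesis by (simp add: twist_def[abs_def] annulus_def)
qed

lemma continuous_annulus: "continuous_on UNIV (annulus n)"
  unfolding annulus_def by (intro continuous_intros)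

text \<open>If the density is nonzero at z or at its image, one of them lies in a disk of some ring
  m. Both have the same \<open>annulus\<close> value, so m = n makes the angle constantly full near
  z, and m \<noteq> n makes it constantly 0. For m = n, ring n is invariant under the rotation and
  the other rings contribute 0 at both points.\<close>

lemma twist_density:
  assumes "cutoff \<kappa>" "9 \<le> n"
  obtains "density \<kappa> z = 0" "density \<kappa> (twist \<kappa> 1 n z) = 0"
  | \<omega> where "norm \<omega> = 1" "density \<kappa> (twist \<kappa> 1 n z) = density \<kappa> z"
    "eventually (\<lambda>y. twist \<kappa> 1 n y = \<omega> * y) (nhds z)"
proof (cases "density \<kappa> z = 0 \<and> density \<kappa> (twist \<kappa> 1 n z) = 0")
  case False
  then obtain y m s where y: "y = z \<or> y = twist \<kappa> 1 n z" "4 \<le> m" "y \<in> disk m s"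
    using density_nonzero_iff[OF assms(1)] by metis
  then have ann: "annulus n z = annulus n y" by (auto simp: annulus_twist)
  show ?thesis
  proof (cases "m = n")
    case True
    then have half: "\<bar>annulus n z\<bar> < 1/2" using annulus_on_ring y(3) assms(2) ann by simp
    let ?\<omega> = "cis (2 * pi / 2 ^ n)"
    have tw: "twist \<kappa> 1 n y = ?\<omega> * y" if "\<bar>annulus n y\<bar> < 1/2" for y
      using that assms(1) by (simp add: twist_def cutoff_def)
    have "open {y. \<bar>annulus n y\<bar> < 1/2}"
      using continuous_annulus by (intro open_Collect_less continuous_intros)
    then have "eventually (\<lambda>y. \<bar>annulus n y\<bar> < 1/2) (nhds z)"
      using half eventually_nhds by blast
    then have "eventually (\<lambda>y. twist \<kappa> 1 n y = ?\<omega> * y) (nhds z)"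
      by eventually_elim (rule tw)
    moreover have "density \<kappa> (?\<omega> * z) = density \<kappa> z"
    proof -
      have "ring_sum \<kappa> k (?\<omega> * z) = ring_sum \<kappa> k z" if "4 \<le> k" for k
      proof (cases "k = n")
        case False
        have "ring_sum \<kappa> k y = 0" if "annulus n y = annulus n z" for y
        proof -
          have "\<not> (\<exists>s. y \<in> disk k s)"
            using annulus_off_ring[of y k _ n] False \<open>4 \<le> k\<close> assms(2) half that by fastforce
          then have "\<not> 0 < ring_sum \<kappa> k y"
            using ring_sum_pos_iff[OF assms(1), of k y] \<open>4 \<le> k\<close> by auto
          then show ?thesis using ring_sum_nonneg[OF assms(1), of k y] by linarith
        qed
        moreover have "annulus n (?\<omega> * z) = annulus n z" by (simp add: annulus_norm norm_mult)
        ultimately show ?thesis by simp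
      qed (simp add: ring_sum_rotate)
      then show ?thesis by (simp add: density_def)
    qed
    ultimately show ?thesis using that(2)[of ?\<omega>] tw[OF half] by simp
  next
    case False
    then have one: "1 < \<bar>annulus n z\<bar>" using annulus_off_ring y assms(2) ann by metis
    have tw: "twist \<kappa> 1 n y = 1 * y" if "1 < \<bar>annulus n y\<bar>" for y
      using that assms(1) by (simp add: twist_def cutoff_def)
    have "open {y. 1 < \<bar>annulus n y\<bar>}"
      using continuous_annulus by (intro open_Collect_less continuous_intros)
    then have "eventually (\<lambda>y. 1 < \<bar>annulus n y\<bar>) (nhds z)"
      using one eventually_nhds by blast
    then have "eventually (\<lambda>y. twist \<kappa> 1 n y = 1 * y) (nhds z)"
      by eventually_elim (rule tw)
    then show ?thesis using that(2)[of 1] tw[OF one] by simp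
  qed
qed (use that in blast)

text \<open>In the plane a linear map acts on bivectors by its determinant, here |\<omega>|^2 =
  1.\<close>

lemma bivector_push_rotation:
  assumes "norm \<omega> = 1"
  shows "bivector_push (Blinfun (\<lambda>h. \<omega> * h)) (c *\<^sub>R wedge 1 \<i>) = c *\<^sub>R wedge 1 \<i>"
proof (intro blinfun_eqI)
  fix \<alpha> \<beta> :: "complex \<Rightarrow>\<^sub>L real"
  have lin: "\<gamma> (Complex a b) = a * \<gamma> 1 + b * \<gamma> \<i>" for \<gamma> :: "complex \<Rightarrow>\<^sub>L real" and a b
  proof -
    have "Complex a b = a *\<^sub>R 1 + b *\<^sub>R \<i>" by (simp add: complex_eq_iff)
    then show ?thesis by (simp only: blinfun.add_right blinfun.scaleR_right) simp
  qed
  obtain a b where ab: "\<omega> = Complex a b" by (cases \<omega>)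
  have 1: "a * a + b * b = 1" using assms ab by (simp add: cmod_def power2_eq_square)
  have i: "\<omega> * \<i> = Complex (-b) a" by (simp add: ab complex_eq_iff)
  have "wedge 1 \<i> (\<alpha> o\<^sub>L Blinfun (\<lambda>h. \<omega> * h)) (\<beta> o\<^sub>L Blinfun (\<lambda>h. \<omega> * h)) =
      \<alpha> \<omega> * \<beta> (\<omega> * \<i>) - \<alpha> (\<omega> * \<i>) * \<beta> \<omega>"
    by (simp add: wedge_apply bounded_linear_Blinfun_apply bounded_linear_mult_right)
  also have "\<dots> = (a * a + b * b) * (\<alpha> 1 * \<beta> \<i> - \<alpha> \<i> * \<beta> 1)"
    unfolding i unfolding ab lin by algebra
  also have "\<dots> = wedge 1 \<i> \<alpha> \<beta>" by (simp add: 1 wedge_apply)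
  finally show "bivector_push (Blinfun (\<lambda>h. \<omega> * h)) (c *\<^sub>R wedge 1 \<i>) \<alpha> \<beta> = (c *\<^sub>R wedge 1 \<i>) \<alpha> \<beta>"
    by (simp add: bivector_push_apply blinfun.bilinear_simps)
qed

section \<open>The twists as Poisson diffeomorphisms\<close>

context disk_in_surface
begin

lemma disk_map_twist:
  assumes "cutoff \<kappa>"
  shows "disk_map (twist \<kappa> \<sigma> (n + 9))"
  unfolding disk_map_def
proof (intro conjI allI impI)
  show "smooth_on UNIV (twist \<kappa> \<sigma> (n + 9))"
    by (rule smooth_on_Ck_lim_nth[OF open_UNIV Ck_lim_twist_tail[OF assms]])
  show "norm (twist \<kappa> \<sigma> (n + 9) z) = norm z" for z by (rule norm_twist)
  show "twist \<kappa> \<sigma> (n + 9) z = z" if "1/2 \<le> norm z" for z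
    using annulus_outside[OF that, of "n + 9"] assms by (simp add: twist_def cutoff_def)
qed

lemma lift_twist_Diff:
  assumes "cutoff \<kappa>"
  shows "lift (twist \<kappa> \<sigma> (n + 9)) \<in> Diff A"
proof (rule lift_Diff[OF disk_map_twist[OF assms] disk_map_twist[OF assms]])
  show "twist \<kappa> (-\<sigma>) (n + 9) (twist \<kappa> \<sigma> (n + 9) z) = z" for z by (rule twist_inverse)
  show "twist \<kappa> \<sigma> (n + 9) (twist \<kappa> (-\<sigma>) (n + 9) z) = z" for z
    using twist_inverse[of \<kappa> "-\<sigma>"] by (simp only: minus_minus)
qed

lemma chart_deriv_lift:
  assumes "disk_map \<Phi>" "q \<in> cdom x" "eventually (\<lambda>y. \<Phi> y = \<omega> * y) (nhds (coord x q))"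
  shows "chart_deriv x x (lift \<Phi>) q = Blinfun (\<lambda>h. \<omega> * h)"
proof -
  obtain S where S: "open S" "coord x q \<in> S" "\<And>y. y \<in> S \<Longrightarrow> \<Phi> y = \<omega> * y"
    using assms(3) unfolding eventually_nhds by blast
  let ?S = "S \<inter> coord x ` cdom x"
  have "open ?S" using S(1) x_chart by (simp add: is_chart_def open_Int)
  have eq: "\<omega> * y = chart_rep x x (lift \<Phi>) y" if "y \<in> ?S" for y
  proof -
    have y: "point y \<in> cdom x" "coord x (point y) = y"
      using point_in_cdom coord_point that by blast+
    have "chart_rep x x (lift \<Phi>) y = \<Phi> y"
      using disk_map_coord(4)[OF assms(1) y(1)] y(2) by (simp add: chart_rep_def)
    then show ?thesis using S(3) that by simp
  qed
  have "coord x q \<in> ?S" using S(2) assms(2) by blast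
  have "((\<lambda>y. \<omega> * y) has_derivative (\<lambda>h. \<omega> * h)) (at (coord x q))"
    by (rule has_derivative_mult_right[OF has_derivative_ident])
  then have D: "(chart_rep x x (lift \<Phi>) has_derivative (\<lambda>h. \<omega> * h)) (at (coord x q))"
    by (rule has_derivative_transform_within_open[OF _ \<open>open ?S\<close> \<open>coord x q \<in> ?S\<close> eq])
  show ?thesis by (simp add: chart_deriv_def frechet_derivative_at[OF D, symmetric])
qed

text \<open>By the chain rule, applied through the chart \<open>x\<close> at the point and at its
  image, the condition in arbitrary charts reduces to the one in \<open>x\<close>. Outside
  \<open>B\<close>, which the lift preserves, both sides are 0.\<close>

lemma lift_pushes_to:
  assumes "disk_map \<Phi>"
    and "\<And>q. q \<in> B \<Longrightarrow> pi_series \<kappa> (\<Phi> (coord x q)) =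
           bivector_push (chart_deriv x x (lift \<Phi>) q) (pi_series \<kappa> (coord x q))"
  shows "pushes_to A (lift \<Phi>) (poisson_structure \<kappa> x B) (poisson_structure \<kappa> x B)"
  unfolding pushes_to_def
proof (intro ballI)
  fix c d q assume c: "c \<in> A" and d: "d \<in> A" and q: "q \<in> cdom c \<inter> lift \<Phi> -` cdom d"
  note smooth = smooth_map_id[OF A] smooth_map_lift[OF assms(1)]
  show "poisson_structure \<kappa> x B (lift \<Phi> q) d =
    bivector_push (chart_deriv c d (lift \<Phi>) q) (poisson_structure \<kappa> x B q c)"
  proof (cases "q \<in> B")
    case True
    then have qx: "q \<in> cdom x" using B by blast
    note lx = disk_map_coord(3,4)[OF assms(1) qx]
    have "chart_deriv c d (lift \<Phi>) q o\<^sub>L chart_deriv x c id q = chart_deriv x d (lift \<Phi>) q"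
      using chart_deriv_compose[OF A smooth x c d qx] q by simp
    also have "\<dots> = chart_deriv x d id (lift \<Phi> q) o\<^sub>L chart_deriv x x (lift \<Phi>) q"
      using chart_deriv_compose[OF A smooth(2,1) x x d qx lx(1)] q by simp
    finally show ?thesis
      using True assms(2)[OF True] lift_in_B_iff[OF assms(1), of q] lx
      by (simp add: poisson_structure_def bivector_push_push)
  next
    case False
    then show ?thesis
      using lift_in_B_iff[OF assms(1), of q] by (simp add: poisson_structure_def bivector_push_zero)
  qed
qed

lemma lift_twist_Poiss:
  assumes "cutoff \<kappa>"
  shows "lift (twist \<kappa> 1 (n + 9)) \<in> Poiss A (poisson_structure \<kappa> x B)"
proof -
  let ?\<Phi> = "twist \<kappa> 1 (n + 9)"
  have "pi_series \<kappa> (?\<Phi> (coord x q)) =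
      bivector_push (chart_deriv x x (lift ?\<Phi>) q) (pi_series \<kappa> (coord x q))" if "q \<in> B" for q
  proof -
    have qx: "q \<in> cdom x" using that B by blast
    show ?thesis
    proof (rule twist_density[OF assms, of "n + 9" "coord x q"])
      assume "density \<kappa> (coord x q) = 0" "density \<kappa> (?\<Phi> (coord x q)) = 0"
      then show ?thesis by (simp add: pi_series_density[OF assms] bivector_push_zero)
    next
      fix \<omega> assume \<omega>: "norm \<omega> = 1" "density \<kappa> (?\<Phi> (coord x q)) = density \<kappa> (coord x q)"
        "eventually (\<lambda>y. ?\<Phi> y = \<omega> * y) (nhds (coord x q))"
      then show ?thesis
        using chart_deriv_lift[OF disk_map_twist[OF assms] qx \<omega>(3)] bivector_push_rotation[OF \<omega>(1)]
        by (simp add: pi_series_density[OF assms])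
    qed simp
  qed
  then show ?thesis
    using lift_twist_Diff[OF assms] lift_pushes_to[OF disk_map_twist[OF assms]] by (simp add: Poiss_def)
qed

section \<open>The non-vanishing locus and its disks\<close>

definition nonzero_set :: "(real \<Rightarrow> real) \<Rightarrow> 'a set" where
  "nonzero_set \<kappa> = {q\<in>B. pi_series \<kappa> (coord x q) \<noteq> 0}"

text \<open>The differential of a diffeomorphism is invertible. If the field vanished at g q,
  pushing it back by the differential of \<open>inv g\<close> would make it vanish at q.\<close>

lemma Poiss_preserves_support:
  assumes "g \<in> Poiss A (poisson_structure \<kappa> x B)" "q \<in> nonzero_set \<kappa>"
  shows "g q \<in> nonzero_set \<kappa>"
proof (rule ccontr)
  assume *: "g q \<notin> nonzero_set \<kappa>"
  let ?P = "poisson_structure \<kappa> x B"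
  have g: "smooth_map A A g" "smooth_map A A (inv g)" "inv g \<circ> g = id" "pushes_to A g ?P ?P"
    using assms(1) by (auto simp: Poiss_def Diff_def dest: bij_is_inj)
  have q: "q \<in> B" "q \<in> cdom x" using assms(2) B by (auto simp: nonzero_set_def)
  obtain d where d: "d \<in> A" "g q \<in> cdom d" using smooth_structure_cover[OF A] .
  have "?P (g q) d = 0"
    using * by (auto simp: nonzero_set_def poisson_structure_def bivector_push_zero)
  moreover have "?P (g q) d = bivector_push (chart_deriv x d g q) (?P q x)"
    using g(4) x d q by (simp add: pushes_to_def)
  ultimately have "bivector_push (chart_deriv x d g q) (pi_series \<kappa> (coord x q)) = 0"
    using poisson_structure_in_disk[OF A x B(1) q(1), of \<kappa>] by simp
  then have "bivector_push (chart_deriv d x (inv g) (g q) o\<^sub>L chart_deriv x d g q) (pi_series \<kappa> (coord x q)) = 0"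
    by (simp add: bivector_push_zero flip: bivector_push_push)
  moreover have "chart_deriv d x (inv g) (g q) o\<^sub>L chart_deriv x d g q = id_blinfun"
  proof -
    have "inv g (g q) = q" using fun_cong[OF g(3), of q] by simp
    then show ?thesis
      using chart_deriv_compose[OF A g(1,2) x d(1) x q(2) d(2)] q(2) g(3) chart_deriv_id[OF A x q(2)] by simp
  qed
  ultimately show False using assms(2) by (simp add: bivector_push_id nonzero_set_def)
qed

lemma disk_subset_cball:
  assumes "4 \<le> n"
  shows "disk n s \<subseteq> cball 0 1"
proof
  fix z assume "z \<in> disk n s"
  then have "\<bar>real n * norm z - 1\<bar> < 1 / 2 ^ n" using disk_norm assms by simp
  also have "\<dots> \<le> 1" by simp
  finally have "real n * norm z < real n * 1" using assms by linarith
  then show "z \<in> cball 0 1" using assms by (simp add: mult_less_cancel_left)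
qed

lemma open_point_disk:
  assumes "4 \<le> n"
  shows "open (point ` disk n s)"
proof -
  have sub: "disk n s \<subseteq> coord x ` cdom x" using disk_subset_cball[OF assms] cball_subset by blast
  have "point ` disk n s = cdom x \<inter> coord x -` disk n s"
  proof safe
    fix z assume "z \<in> disk n s"
    then show "point z \<in> cdom x" "point z \<in> coord x -` disk n s"
      using sub point_in_cdom[of z] coord_point[of z] by (auto simp del: mem_ball)
  next
    fix q assume "q \<in> cdom x" "coord x q \<in> disk n s"
    then show "q \<in> point ` disk n s" by (intro image_eqI[where x = "coord x q"]) (simp_all add: point_coord)
  qed
  moreover have "open (cdom x \<inter> coord x -` disk n s)"
    by (rule continuous_open_preimage[OF is_chart_continuous_on(1)[OF x_chart] open_cdom[OF x] open_ball])
  ultimately show ?thesis by simp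
qed

lemma nonzero_set_eq:
  assumes "cutoff \<kappa>"
  shows "nonzero_set \<kappa> = (\<Union>n\<in>{4..}. \<Union>s\<in>{1..2^n}. point ` disk n s)"
proof -
  have *: "pi_series \<kappa> z \<noteq> 0 \<longleftrightarrow> (\<exists>n\<in>{4..}. \<exists>s\<in>{1..2^n}. z \<in> disk n s)" for z
    using density_nonzero_iff[OF assms, of z] by (auto simp: pi_series_density[OF assms] wedge_1_i_nonzero)
  show ?thesis
  proof (intro equalityI subsetI)
    fix q assume "q \<in> nonzero_set \<kappa>"
    then have "q \<in> B" "pi_series \<kappa> (coord x q) \<noteq> 0" by (auto simp: nonzero_set_def)
    then obtain n s where n: "n \<in> {4..}" "s \<in> {1..2^n}" "coord x q \<in> disk n s" using * by blast
    have "q \<in> cdom x" using \<open>q \<in> B\<close> B(1) by blast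
    then have "q \<in> point ` disk n s"
      using n(3) by (intro image_eqI[where x = "coord x q"]) (simp_all add: point_coord)
    with n show "q \<in> (\<Union>n\<in>{4..}. \<Union>s\<in>{1..2^n}. point ` disk n s)" by blast
  next
    fix q assume "q \<in> (\<Union>n\<in>{4..}. \<Union>s\<in>{1..2^n}. point ` disk n s)"
    then obtain n s z where n: "n \<in> {4..}" "s \<in> {1..2^n}" "z \<in> disk n s" "q = point z" by blast
    then have z: "z \<in> cball 0 1" using disk_subset_cball[of n s] by auto
    then have "q \<in> cdom x" "coord x q = z"
      using n(4) cball_subset point_in_cdom[of z] coord_point[of z] by auto
    moreover have "pi_series \<kappa> z \<noteq> 0" using * n by blast
    ultimately show "q \<in> nonzero_set \<kappa>"
      using in_B_iff[of q] z by (simp add: nonzero_set_def)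
  qed
qed

theorem Poiss_not_locally_path_connected:
  assumes \<kappa>: "cutoff \<kappa>"
  shows "\<not> locally_path_connected_space (Poiss_topology A (poisson_structure \<kappa> x B))"
proof
  let ?P = "poisson_structure \<kappa> x B"
  let ?X = "Poiss_topology A ?P"
  define \<phi> where "\<phi> n = lift (twist \<kappa> 1 (n + 9))" for n
  assume lpc: "locally_path_connected_space ?X"
  \<comment> \<open>\<open>Poiss\<close> is contained in \<open>Diff\<close>, so the twice
    restricted topology is a single subspace of the mapping space.\<close>
  have top: "?X = subtopology (Cinf_topology A A) (Poiss A ?P)"
    by (simp add: Poiss_topology_def Diff_topology_def subtopology_subtopology Poiss_def
        inf.absorb2 subset_iff)
  have smooth: "smooth_map A A g" if "g \<in> Poiss A ?P" for g
    using that by (simp add: Poiss_def Diff_def)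
  have lift_id: "lift (\<lambda>z. z) = id"
    using B by (auto simp: lift_def fun_eq_iff point_coord)
  have "disk_map (\<lambda>z. z)"
    using smooth_on_bounded_linear[OF bounded_linear_ident] by (simp add: disk_map_def)
  then have id: "id \<in> Poiss A ?P"
    unfolding Poiss_def
  proof safe
    show "id \<in> Diff A" using smooth_map_id[OF A] by (simp add: Diff_def)
    have "pushes_to A (lift (\<lambda>z. z)) ?P ?P"
    proof (rule lift_pushes_to[OF \<open>disk_map (\<lambda>z. z)\<close>], unfold lift_id)
      fix q assume "q \<in> B"
      then have "chart_deriv x x id q = id_blinfun" using chart_deriv_id[OF A x] B(1) by blast
      then show "pi_series \<kappa> (coord x q) = bivector_push (chart_deriv x x id q) (pi_series \<kappa> (coord x q))"
        by (simp only: bivector_push_id)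
    qed
    then show "pushes_to A id ?P ?P" by (simp only: lift_id)
  qed
  then have "id \<in> topspace ?X" using topspace_Cinf smooth by (simp add: top)
  then have "id \<in> Collect (path_component_of ?X id)" by (simp add: path_component_of_refl)
  \<comment> \<open>The only consequence of local path-connectedness that is used: the path
    component of the identity is open, so it contains all Poisson maps in some neighbourhood
    \<open>W\<close>.\<close>
  moreover have "openin ?X (Collect (path_component_of ?X id))"
    by (rule openin_path_component_of_locally_path_connected_space[OF lpc])
  ultimately obtain W where W: "openin (Cinf_topology A A) W" "id \<in> W"
    "W \<inter> Poiss A ?P \<subseteq> Collect (path_component_of ?X id)"
    unfolding top openin_subtopology by blast
  have "eventually (\<lambda>n. \<phi> n \<in> W) sequentially"
    unfolding \<phi>_def
    by (rule lift_eventually_open[where \<Phi> = "\<lambda>n. twist \<kappa> 1 (n + 9)",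
          OF disk_map_twist[OF \<kappa>] Ck_lim_twist_tail[OF \<kappa>] W(1,2)])
  then obtain k where "\<phi> k \<in> W" by (auto simp: eventually_sequentially)
  then have "path_component_of ?X id (\<phi> k)"
    using W(3) lift_twist_Poiss[OF \<kappa>] by (auto simp: \<phi>_def)
  then obtain \<gamma> where \<gamma>: "pathin ?X \<gamma>" "\<gamma> 0 = id" "\<gamma> 1 = \<phi> k"
    unfolding path_component_of_def by blast
  define n where "n = k + 9"
  define q where "q = point (centre n 1)"
  define U where "U = point ` disk n 1"
  \<comment> \<open>\<open>U\<close> is one disk and \<open>V\<close> the union of all others, of
    the same ring and of all other rings. Both are open and together they cover the non-vanishing
    locus, so a connected set inside it cannot meet both.\<close>
  define V where "V = \<Union>{point ` disk m s | m s. 4 \<le> m \<and> s \<in> {1..2^m} \<and> (m, s) \<noteq> (n, 1)}"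
  have V_I: "point z \<in> V" if "z \<in> disk m s" "4 \<le> m" "s \<in> {1..2^m}" "(m, s) \<noteq> (n, 1)" for z m s
    using that unfolding V_def by blast
  have V_E: "\<exists>z m s. p = point z \<and> z \<in> disk m s \<and> 4 \<le> m \<and> s \<in> {1..2^m} \<and> (m, s) \<noteq> (n, 1)"
    if "p \<in> V" for p
    using that unfolding V_def by blast
  have n: "9 \<le> n" by (simp add: n_def)
  have in_coord: "z \<in> coord x ` cdom x" if "z \<in> disk m s" "4 \<le> m" for z m s
    using that disk_subset_cball cball_subset by blast
  have centre: "centre m s \<in> disk m s" if "0 < m" for m s
    using disk_radius_pos[OF that] by simp
  have "U \<inter> V = {}"
  proof -
    have no_overlap: False if z: "z \<in> disk n 1" and w: "w \<in> disk m s" and m: "4 \<le> m" "s \<in> {1..2^m}" "(m, s) \<noteq> (n, 1)"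
      and eq: "point z = point w" for z w m s
    proof -
      have "4 \<le> n" using n by simp
      have "z = coord x (point z)" by (rule coord_point[OF in_coord[OF z \<open>4 \<le> n\<close>], symmetric])
      also have "\<dots> = coord x (point w)" by (rule arg_cong[OF eq])
      also have "\<dots> = w" by (rule coord_point[OF in_coord[OF w m(1)]])
      finally have "z = w" .
      show False
      proof (cases "m = n")
        case True
        have "1 \<in> {1..(2::nat)^n}" "s \<in> {1..2^n}" "1 \<noteq> s" "0 < n"
          using m n True by auto
        moreover have "w \<in> disk n 1" "w \<in> disk n s" using z w unfolding \<open>z = w\<close> True by this+
        ultimately show False using disks_disjoint by blast
      next
        case False
        have "\<bar>annulus n w\<bar> < 1/2" using annulus_on_ring[OF z n] \<open>z = w\<close> by (simp only:)
        then show False using annulus_off_ring[OF w m(1) n False] by linarith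
      qed
    qed
    show ?thesis
    proof (intro equals0I, elim IntE)
      fix p assume "p \<in> U" "p \<in> V"
      then obtain z where z: "z \<in> disk n 1" "p = point z" unfolding U_def by blast
      obtain w m s where w: "p = point w" "w \<in> disk m s" "4 \<le> m" "s \<in> {1..2^m}" "(m, s) \<noteq> (n, 1)"
        using V_E[OF \<open>p \<in> V\<close>] by blast
      show False by (rule no_overlap[OF z(1) w(2-5)]) (use z w in simp)
    qed
  qed
  have UV: "nonzero_set \<kappa> \<subseteq> U \<union> V"
  proof
    fix p assume "p \<in> nonzero_set \<kappa>"
    then obtain m s z where p: "4 \<le> m" "s \<in> {1..2^m}" "z \<in> disk m s" "p = point z"
      unfolding nonzero_set_eq[OF \<kappa>] by blast
    show "p \<in> U \<union> V"
    proof (cases "(m, s) = (n, 1)")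
      case True
      then show ?thesis using p unfolding U_def by blast
    next
      case False
      then show ?thesis using p V_I by blast
    qed
  qed
  have oU: "open U" unfolding U_def using n by (intro open_point_disk) simp
  have oV: "open V" unfolding V_def by (rule open_Union) (use open_point_disk in blast)
  have \<gamma>P: "\<gamma> t \<in> Poiss A ?P" if "t \<in> {0..1}" for t
  proof -
    have "\<gamma> ` {0..1} \<subseteq> topspace ?X"
      using continuous_map_image_subset_topspace[OF \<gamma>(1)[unfolded pathin_def]] by simp
    moreover have "topspace ?X \<subseteq> Poiss A ?P" by (simp add: top)
    ultimately show ?thesis using that by blast
  qed
  \<comment> \<open>The path in the group is only used through the orbit of the single point
    \<open>q\<close>, a continuous path in the surface that starts at \<open>q\<close> in
    \<open>U\<close>.\<close>
  have cont: "continuous_on {0..1} (\<lambda>t. \<gamma> t q)"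
  proof (subst continuous_on_open_gen[where T = UNIV])
    show "\<forall>S. openin (top_of_set UNIV) S \<longrightarrow> openin (top_of_set {0..1}) ({0..1} \<inter> (\<lambda>t. \<gamma> t q) -` S)"
    proof safe
      fix S :: "'a set" assume "openin (top_of_set UNIV) S"
      then have "open S" by simp
      have "openin ?X (Poiss A ?P \<inter> {f. smooth_map A A f \<and> f q \<in> S})"
        unfolding top by (rule openin_subtopology_Int2[OF openin_evaluation[OF \<open>open S\<close>]])
      then have "openin (top_of_set {0..1}) {t \<in> topspace (top_of_set {0..1}). \<gamma> t \<in> Poiss A ?P \<inter> {f. smooth_map A A f \<and> f q \<in> S}}"
        by (intro openin_continuous_map_preimage[OF \<gamma>(1)[unfolded pathin_def]])
      moreover have "{t \<in> topspace (top_of_set {0..1}). \<gamma> t \<in> Poiss A ?P \<inter> {f. smooth_map A A f \<and> f q \<in> S}} =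
          {0..1} \<inter> (\<lambda>t. \<gamma> t q) -` S"
        using \<gamma>P smooth by auto
      ultimately show "openin (top_of_set {0..1}) ({0..1} \<inter> (\<lambda>t. \<gamma> t q) -` S)" by simp
    qed
  qed auto
  have qS: "q \<in> nonzero_set \<kappa>"
    unfolding nonzero_set_eq[OF \<kappa>] q_def using centre[of n 1] n
    by (intro UN_I[of n] UN_I[of 1] imageI) auto
  have "connected ((\<lambda>t. \<gamma> t q) ` {0..1})"
    by (rule connected_continuous_image[OF cont]) simp
  from connectedD[OF this oU oV] have "U \<inter> (\<lambda>t. \<gamma> t q) ` {0..1} = {} \<or> V \<inter> (\<lambda>t. \<gamma> t q) ` {0..1} = {}"
    if "(\<lambda>t. \<gamma> t q) ` {0..1} \<subseteq> U \<union> V"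
    using that \<open>U \<inter> V = {}\<close> by simp
  moreover have "(\<lambda>t. \<gamma> t q) ` {0..1} \<subseteq> U \<union> V"
  proof
    fix p assume "p \<in> (\<lambda>t. \<gamma> t q) ` {0..1}"
    then obtain t where "t \<in> {0..1}" "p = \<gamma> t q" by (rule imageE)
    then have "p \<in> nonzero_set \<kappa>" using Poiss_preserves_support[OF \<gamma>P qS] by simp
    then show "p \<in> U \<union> V" using UV by (rule subsetD[rotated])
  qed
  moreover have "q \<in> U \<inter> (\<lambda>t. \<gamma> t q) ` {0..1}"
    using centre[of n 1] n \<gamma>(2) unfolding U_def q_def by (auto intro!: image_eqI[of _ _ 0] simp del: mem_ball)
  moreover have "\<phi> k q \<in> V \<inter> (\<lambda>t. \<gamma> t q) ` {0..1}"
  proof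
    have c: "centre n 1 \<in> disk n 1" using centre n by simp
    have qx: "q \<in> cdom x" "coord x q = centre n 1"
      using in_coord[OF c] n point_in_cdom coord_point by (auto simp: q_def)
    have "\<phi> k q = point (twist \<kappa> 1 n (centre n 1))"
      using disk_map_coord(1)[OF disk_map_twist[OF \<kappa>] qx(1)] qx(2) by (simp add: \<phi>_def n_def)
    \<comment> \<open>At a centre of ring n the value of \<open>annulus n\<close> is in the plateau
      of \<kappa>, so the full angle acts and carries centre 1 to centre 2, whose disk belongs to
      \<open>V\<close>.\<close>
    also have "twist \<kappa> 1 n (centre n 1) = centre n 2"
      using annulus_on_ring[OF c n] \<kappa> centre_Suc[of n 1] by (simp add: twist_def cutoff_def numeral_2_eq_2)
    finally have "\<phi> k q = point (centre n 2)" .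
    moreover have "2 \<in> {1..(2::nat)^n}" using n self_le_power[of 2 n] by auto
    ultimately show "\<phi> k q \<in> V" using V_I[OF centre[of n 2]] n by simp
    show "\<phi> k q \<in> (\<lambda>t. \<gamma> t q) ` {0..1}" using \<gamma>(3) by (auto intro!: image_eqI[of _ _ 1])
  qed
  ultimately show False
    by (metis empty_iff)
qed

end

theorem mainTheorem1:
  fixes A :: "('a::{t2_space,second_countable_topology}, complex) chart set"
    and x :: "('a, complex) chart"
    and B :: "'a set"
    and \<kappa> :: "real \<Rightarrow> real"
  assumes "compact (UNIV :: 'a set)"
    and "smooth_structure A"
    and "x \<in> A" and "B \<subseteq> cdom x" and "coord x ` B = cball 0 1"
    and "cutoff \<kappa>"
  shows "\<not> locally_path_connected_space (Poiss_topology A (poisson_structure \<kappa> x B))"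
proof -
  interpret disk_in_surface A x B using assms by unfold_locales
  show ?thesis using assms by (intro Poiss_not_locally_path_connected)
qed

end
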